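(* Let $T\in(0,\infty)$, $d\in\mathbb{N}$, $u_0\in\mathbb{R}^d$, $\gamma\in(0,1]$, and let $f\colon[0,T]\times\mathbb{R}^d\to\mathbb{R}^d$ be continuous. Suppose there exist $L,K\in(0,\infty)$ such that $$|f(t,x_1)-f(t,x_2)|\le L|x_1-x_2|\quad\text{for all }t\in[0,T],\ x_1,x_2\in\mathbb{R}^d,$$ $$|f(t_1,x)-f(t_2,x)|\le K(1+|x|)|t_1-t_2|^\gamma\quad\text{for all }t_1,t_2\in[0,T],\ x\in\mathbb{R}^d.$$ Let $u$ be the exact solution to $\dot u(t)=f(t,u(t))$, $t\in[0,T]$, $u(0)=u_0$. For given step size $h\in(0,1)$ let $(U^j)_{j\in\{0,1,\ldots,N_h\}}$ be determined by $U^0=u_0$ and $$U^j=U^{j-1}+hf(t_{j-1}+\tau_jh,U^{j-1}),\quad j\in\{1,\ldots,N_h\},$$ and let $(V^j)_{j\in\{0,1,\ldots,N_h\}}$ be determined by $V^0=u_0$ and $$V^j_\tau=V^{j-1}+h\tau_jf(t_{j-1},V^{j-1}),\qquad V^j=V^{j-1}+hf(t_{j-1}+\tau_jh,V^j_\tau),\quad j\in\{1,\ldots,N_h\}.$$ Then for every $p\in[2,\infty)$ there exists a constant $C_U\in(0,\infty)$, independent of $h\in(0,1)$, such that $$\Big\|\max_{n\in\{0,1,\ldots,N_h\}}|u(t_n)-U^n|\Big\|_{L^p(\Omega;\mathbb{R})}\le C_Uh^{\min(\frac12+\gamma,1)}.$$ Moreover, for every $p\in[2,\infty)$ there exists a constant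 $C_V\in(0,\infty)$, independent of $h\in(0,1)$, such that $$\Big\|\max_{n\in\{0,1,\ldots,N_h\}}|u(t_n)-V^n|\Big\|_{L^p(\Omega;\mathbb{R})}\le C_Vh^{\frac12+\gamma}.$$
   Context: $|\cdot|$ is the Euclidean norm on $\mathbb{R}^d$. $(\tau_j)_{j\in\mathbb{N}}$ is an independent family of random variables, each uniformly distributed on $(0,1)$, on a probability space $(\Omega,\mathcal{F},\mathbb{P})$. $\|X\|_{L^p(\Omega;\mathbb{R})}=(\mathbb{E}[|X|^p])^{1/p}$. For $h\in(0,1)$, $t_j=jh$ and $N_h\in\{0,1,2,\ldots\}$ is the integer determined by $N_hh\le T<(N_h+1)h$. Under the stated hypotheses on $f$ the initial value problem has a unique global solution $u\colon[0,T]\to\mathbb{R}^d$, which is continuously differentiable. *)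

theory Defs
  imports "HOL-Probability.Probability"
begin

text \<open>\<open>u\<close> is a solution on \<open>[0,T]\<close>; the derivatives at \<open>0\<close> and \<open>T\<close> are one-sided.\<close>

definition solves_ivp ::
  "real \<Rightarrow> (real \<Rightarrow> 'v \<Rightarrow> 'v) \<Rightarrow> 'v \<Rightarrow> (real \<Rightarrow> 'v::real_normed_vector) \<Rightarrow> bool" where
  "solves_ivp T f u\<^sub>0 u \<longleftrightarrow>
     u 0 = u\<^sub>0 \<and>
     (\<forall>t\<in>{0..T}. (u has_vector_derivative f t (u t)) (at t within {0..T}))"

definition num_steps :: "real \<Rightarrow> real \<Rightarrow> nat" where
  "num_steps T h = (THE N. real N * h \<le> T \<and> T < (real N + 1) * h)"

lemma num_steps_unique:
  assumes "0 < h" "real N * h \<le> T" "T < (real N + 1) * h"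
      and "real N' * h \<le> T" "T < (real N' + 1) * h"
  shows "N = N'"
proof -
  have "real N * h < (real N' + 1) * h" "real N' * h < (real N + 1) * h"
    using assms by linarith+
  then have "real N < real N' + 1" "real N' < real N + 1"
    using assms(1) by (simp_all only: mult_less_cancel_right_pos)
  then show ?thesis by linarith
qed

lemma num_steps:
  assumes "0 \<le> T" "0 < h"
  shows "real (num_steps T h) * h \<le> T" "T < (real (num_steps T h) + 1) * h"
proof -
  define N where "N = nat \<lfloor>T / h\<rfloor>"
  have r: "real N = of_int \<lfloor>T / h\<rfloor>"
    using assms by (simp add: N_def)
  have "real N \<le> T / h" "T / h < real N + 1"
    unfolding r by linarith+
  then have "real N * h \<le> T \<and> T < (real N + 1) * h"
    using assms by (simp add: field_simps)
  then have "real (num_steps T h) * h \<le> T \<and> T < (real (num_steps T h) + 1) * h"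
    unfolding num_steps_def
    by (rule theI) (use num_steps_unique[OF assms(2)] \<open>real N * h \<le> T \<and> _\<close> in blast)
  then show "real (num_steps T h) * h \<le> T" "T < (real (num_steps T h) + 1) * h"
    by auto
qed

text \<open>The two schemes for one realization \<open>\<theta> j = \<tau>\<^sub>j(\<omega>)\<close>. The recursions run through all
  \<open>j\<close>; only the indices up to \<^term>\<open>num_steps T h\<close> are meaningful.\<close>

primrec rand_euler ::
  "(real \<Rightarrow> 'v \<Rightarrow> 'v) \<Rightarrow> 'v \<Rightarrow> real \<Rightarrow> (nat \<Rightarrow> real) \<Rightarrow> nat \<Rightarrow> 'v::real_normed_vector" where
  "rand_euler f u\<^sub>0 h \<theta> 0 = u\<^sub>0"
| "rand_euler f u\<^sub>0 h \<theta> (Suc j) =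
     rand_euler f u\<^sub>0 h \<theta> j
       + h *\<^sub>R f (real j * h + \<theta> (Suc j) * h) (rand_euler f u\<^sub>0 h \<theta> j)"

primrec rand_rk ::
  "(real \<Rightarrow> 'v \<Rightarrow> 'v) \<Rightarrow> 'v \<Rightarrow> real \<Rightarrow> (nat \<Rightarrow> real) \<Rightarrow> nat \<Rightarrow> 'v::real_normed_vector" where
  "rand_rk f u\<^sub>0 h \<theta> 0 = u\<^sub>0"
| "rand_rk f u\<^sub>0 h \<theta> (Suc j) =
     (let v = rand_rk f u\<^sub>0 h \<theta> j;
          v\<^sub>\<tau> = v + (h * \<theta> (Suc j)) *\<^sub>R f (real j * h) v
      in v + h *\<^sub>R f (real j * h + \<theta> (Suc j) * h) v\<^sub>\<tau>)"

definition max_error ::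
  "real \<Rightarrow> real \<Rightarrow> (real \<Rightarrow> 'v::real_normed_vector) \<Rightarrow> (nat \<Rightarrow> 'v) \<Rightarrow> real" where
  "max_error T h u U = (MAX n\<in>{0..num_steps T h}. norm (u (real n * h) - U n))"

text \<open>The law of \<open>\<tau>\<^sub>j\<close> only forces \<open>\<tau>\<^sub>j \<in> (0,1)\<close> almost surely. On the exceptional null event
  the schemes may evaluate \<open>f\<close> at times outside \<open>[0,T]\<close>, where the HOL function \<open>f\<close> is arbitrary,
  so the error is a random variable only up to a null set. Measurability and integrals are
  therefore taken with respect to the completed measure, which changes neither the law nor the
  \<open>L\<^sup>p\<close> norm of an \<open>M\<close>-measurable random variable. Membership in \<open>L\<^sup>p\<close> is a
  separate predicate because the Bochner integral of a non-integrable function is \<open>0\<close>.\<close>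

definition in_Lp :: "'a measure \<Rightarrow> real \<Rightarrow> ('a \<Rightarrow> real) \<Rightarrow> bool" where
  "in_Lp M p X \<longleftrightarrow>
     X \<in> borel_measurable (completion M) \<and>
     integrable (completion M) (\<lambda>\<omega>. \<bar>X \<omega>\<bar> powr p)"

definition Lp_norm :: "'a measure \<Rightarrow> real \<Rightarrow> ('a \<Rightarrow> real) \<Rightarrow> real" where
  "Lp_norm M p X = (\<integral>\<omega>. \<bar>X \<omega>\<bar> powr p \<partial>completion M) powr (1 / p)"

end

theory Submission
  imports Defs
begin

text \<open>Write \<open>g(t) = f(t, u(t))\<close>, which is \<open>\<gamma>\<close>-Hoelder. The defects
  \<open>h g(t\<^sub>j + \<tau>\<^sub>j\<^sub>+\<^sub>1 h) - (u(t\<^sub>j\<^sub>+\<^sub>1) - u(t\<^sub>j))\<close> are independent, centred (the quadrature rule is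
  unbiased) and bounded by \<open>C h\<^bsup>1+\<gamma>\<^esup>\<close>. The error of either scheme is minus the sum of the defects
  plus \<open>h\<close> times Lipschitz-controlled terms, so by a pathwise discrete Gronwall
  inequality its maximum is at most a constant times the maximal partial sum of the defects plus
  the stage error, which is \<open>O(h)\<close> for the Euler scheme and \<open>O(h\<^bsup>1+\<gamma>\<^esup>)\<close> for the Runge-Kutta scheme.

  Since the defects are bounded, no Burkholder-Davis-Gundy inequality is needed: Doob's
  \<open>L\<^sup>2\<close> inequality for the submartingale \<open>exp(l S\<^sub>k / 2)\<close> together with Hoeffding's lemma bounds
  \<open>E max\<^sub>k exp(l S\<^sub>k)\<close>, and \<open>l = 1/\<sigma>\<close> with \<open>\<sigma>\<^sup>2\<close> the sum of the squared bounds gives all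
  moments of \<open>max\<^sub>k |S\<^sub>k|\<close> at the scale \<open>\<sigma> \<le> C h\<^bsup>1/2+\<gamma>\<^esup>\<close>.\<close>

subsection \<open>Maximal inequalities for independent random variables\<close>

text \<open>A deterministic form of Doob's L^2 maximal inequality: for a submartingale with
  nonnegative running maximum the last sum has nonnegative expectation and drops out.\<close>

lemma doob_l2_pathwise:
  fixes x :: "nat \<Rightarrow> real"
  shows "(Max (x ` {..n}))\<^sup>2 \<le>
    4 * (x n)\<^sup>2 - 4 * (\<Sum>i<n. Max (x ` {..i}) * (x (Suc i) - x i))"
proof -
  define m where "m k = Max (x ` {..k})" for k
  define s where "s k = (\<Sum>i<k. m i * (x (Suc i) - x i))" for k
  have m_Suc: "m (Suc k) = max (x (Suc k)) (m k)" for k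
    by (simp add: m_def atMost_Suc)
  \<comment> \<open>Without a new record both sides grow by the same amount; a new record adds the
    slack \<open>(x (Suc n) - m n)\<^sup>2\<close>. Completing a square afterwards removes the mixed
    product \<open>x n * m n\<close>.\<close>
  have "(m n)\<^sup>2 + 2 * s n \<le> 2 * x n * m n"
  proof (induction n)
    case 0
    then show ?case by (simp add: m_def s_def power2_eq_square)
  next
    case (Suc n)
    have s: "s (Suc n) = s n + m n * (x (Suc n) - x n)"
      by (simp add: s_def)
    show ?case
    proof (cases "x (Suc n) \<le> m n")
      case True
      then have "m (Suc n) = m n" by (simp add: m_Suc)
      then show ?thesis using Suc by (simp add: s algebra_simps)
    next
      case False
      then have "m (Suc n) = x (Suc n)" by (simp add: m_Suc)
      moreover have "0 \<le> (x (Suc n) - m n)\<^sup>2" by simp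
      ultimately show ?thesis using Suc
        by (simp add: s power2_eq_square algebra_simps)
    qed
  qed
  moreover have "0 \<le> (m n - 2 * x n)\<^sup>2" by simp
  ultimately have "(m n)\<^sup>2 \<le> 4 * (x n)\<^sup>2 - 4 * s n"
    by (simp add: power2_eq_square algebra_simps)
  then show ?thesis by (simp add: m_def s_def)
qed

text \<open>A sum is at most the number of terms times the largest one, whose power is among the
  summands on the right. This is cruder than convexity but covers every
  \<open>p > 0\<close>.\<close>

lemma sum_powr_le:
  fixes a :: "'i \<Rightarrow> real"
  assumes "finite I" "\<And>i. i \<in> I \<Longrightarrow> 0 \<le> a i" "p > 0"
  shows "(\<Sum>i\<in>I. a i) powr p \<le> real (card I) powr p * (\<Sum>i\<in>I. a i powr p)"
proof (cases "I = {}")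
  case False
  define m where "m = Max (a ` I)"
  have "m \<in> a ` I" using assms False by (auto simp: m_def)
  then obtain k where k: "k \<in> I" "m = a k" by auto
  have "(\<Sum>i\<in>I. a i) \<le> real (card I) * m"
    using assms by (intro sum_bounded_above) (auto simp: m_def)
  then have "(\<Sum>i\<in>I. a i) powr p \<le> (real (card I) * m) powr p"
    using assms by (intro powr_mono2 sum_nonneg) auto
  also have "\<dots> = real (card I) powr p * a k powr p"
    using k by (simp add: powr_mult)
  also have "a k powr p \<le> (\<Sum>i\<in>I. a i powr p)"
    using k assms by (intro member_le_sum) auto
  finally show ?thesis by (simp add: mult_left_mono)
qed simp

text \<open>Raise \<open>y / p \<le> exp (y / p)\<close> to the power \<open>p\<close>. Exponential
  moments thereby control moments of every order.\<close>

lemma powr_le_exp: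
  fixes y p :: real
  assumes "0 \<le> y" "p > 0"
  shows "y powr p \<le> p powr p * exp y"
proof -
  have "y / p \<le> exp (y / p)"
    using exp_ge_add_one_self[of "y / p"] by linarith
  then have "(y / p) powr p \<le> exp (y / p) powr p"
    using assms by (intro powr_mono2) auto
  also have "\<dots> = exp y"
    using assms by (simp add: powr_def)
  finally show ?thesis
    using assms by (simp add: powr_divide field_simps)
qed

context prob_space
begin

text \<open>The hypothesis on the means makes the products a submartingale; its filtration is avoided by
  factoring each increment of the pathwise inequality through independence.\<close>

lemma expectation_max_prod_square_le:
  fixes Y :: "nat \<Rightarrow> 'a \<Rightarrow> real"
  assumes indep: "indep_vars (\<lambda>_. borel) Y {..<n}"
    and Y_nonneg: "\<And>i \<omega>. i < n \<Longrightarrow> \<omega> \<in> space M \<Longrightarrow> 0 \<le> Y i \<omega>"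
    and Y_le: "\<And>i \<omega>. i < n \<Longrightarrow> \<omega> \<in> space M \<Longrightarrow> Y i \<omega> \<le> B"
    and Y_mean: "\<And>i. i < n \<Longrightarrow> 1 \<le> expectation (Y i)"
  defines "X \<equiv> \<lambda>k \<omega>. \<Prod>i<k. Y i \<omega>"
  shows "integrable M (\<lambda>\<omega>. (Max ((\<lambda>k. X k \<omega>) ` {..n}))\<^sup>2)"
    and "expectation (\<lambda>\<omega>. (Max ((\<lambda>k. X k \<omega>) ` {..n}))\<^sup>2)
           \<le> 4 * (\<Prod>i<n. expectation (\<lambda>\<omega>. (Y i \<omega>)\<^sup>2))"
proof -
  \<comment> \<open>The maximum with 1 makes the powers increase with the exponent, so one constant
    bounds all partial products. It serves only integrability.\<close>
  define D where "D = (max 1 B) ^ n"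
  define m where "m = (\<lambda>k \<omega>. Max ((\<lambda>j. X j \<omega>) ` {..k}))"
  have Y_meas[measurable]: "Y i \<in> borel_measurable M" if "i < n" for i
    using indep that by (auto simp: indep_vars_def)
  have X_meas[measurable]: "X k \<in> borel_measurable M" if "k \<le> n" for k
    unfolding X_def using that by (intro borel_measurable_prod) auto
  have m_meas[measurable]: "m k \<in> borel_measurable M" if "k \<le> n" for k
    unfolding m_def using that by (intro borel_measurable_Max) auto
  have X_nonneg: "0 \<le> X k \<omega>" if "k \<le> n" "\<omega> \<in> space M" for k \<omega>
    unfolding X_def using that Y_nonneg by (intro prod_nonneg) auto
  have X_le: "X k \<omega> \<le> D" if "k \<le> n" "\<omega> \<in> space M" for k \<omega>
  proof -
    have "X k \<omega> \<le> (\<Prod>i<k. max 1 B)"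
      unfolding X_def using that Y_nonneg Y_le by (intro prod_mono) (auto simp: le_max_iff_disj)
    also have "\<dots> \<le> D"
      using that by (simp add: D_def power_increasing)
    finally show ?thesis .
  qed
  have m_ge: "0 \<le> m k \<omega>" if "k \<le> n" "\<omega> \<in> space M" for k \<omega>
    unfolding m_def using X_nonneg[of 0] that by (subst Max_ge_iff) auto
  have m_le: "m k \<omega> \<le> D" if "k \<le> n" "\<omega> \<in> space M" for k \<omega>
    unfolding m_def using X_le that by (subst Max_le_iff) auto
  have D: "0 \<le> D" by (simp add: D_def)
  have int_m: "integrable M (\<lambda>\<omega>. (m n \<omega>)\<^sup>2)"
    by (rule integrable_const_bound[of _ "D\<^sup>2"])
       (use m_ge[of n] m_le[of n] in \<open>auto intro!: power_mono\<close>)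
  then show "integrable M (\<lambda>\<omega>. (Max ((\<lambda>k. X k \<omega>) ` {..n}))\<^sup>2)"
    by (simp add: m_def)
  have int_X: "integrable M (\<lambda>\<omega>. (X n \<omega>)\<^sup>2)"
    by (rule integrable_const_bound[of _ "D\<^sup>2"])
       (use X_nonneg[of n] X_le[of n] in \<open>auto intro!: power_mono\<close>)
  have X_Suc: "X (Suc i) \<omega> - X i \<omega> = X i \<omega> * (Y i \<omega> - 1)" for i \<omega>
    by (simp add: X_def algebra_simps)
  have int_mX: "integrable M (\<lambda>\<omega>. m i \<omega> * X i \<omega>)" if "i < n" for i
  proof (rule integrable_const_bound[of _ "D * D"])
    show "AE \<omega> in M. norm (m i \<omega> * X i \<omega>) \<le> D * D"
      using that m_ge[of i] m_le[of i] X_nonneg[of i] X_le[of i] D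
      by (auto simp: abs_mult intro!: mult_mono)
    show "(\<lambda>\<omega>. m i \<omega> * X i \<omega>) \<in> borel_measurable M"
      using that by (intro borel_measurable_times m_meas X_meas) auto
  qed
  have int_Y: "integrable M (Y i)" if "i < n" for i
  proof (rule integrable_const_bound[of _ B])
    show "AE \<omega> in M. norm (Y i \<omega>) \<le> B"
      using Y_nonneg[OF that] Y_le[OF that] by auto
  qed (use that in measurable)
  have incr: "integrable M (\<lambda>\<omega>. m i \<omega> * (X (Suc i) \<omega> - X i \<omega>))"
    "0 \<le> expectation (\<lambda>\<omega>. m i \<omega> * (X (Suc i) \<omega> - X i \<omega>))" if i: "i < n" for i
  proof -
    \<comment> \<open>\<open>m i\<close> and \<open>X i\<close> are functions of the factors with
      index below \<open>i\<close>, so their product is independent of \<open>Y i\<close>, the only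
      new factor in the increment.\<close>
    define F :: "(nat \<Rightarrow> real) \<Rightarrow> real" where
      "F y = Max ((\<lambda>j. \<Prod>l<j. y l) ` {..i}) * (\<Prod>l<i. y l)" for y
    have "indep_var borel (F \<circ> (\<lambda>\<omega>. \<lambda>l\<in>{..<i}. Y l \<omega>))
        borel ((\<lambda>y. y i - 1) \<circ> (\<lambda>\<omega>. \<lambda>l\<in>{i}. Y l \<omega>))"
    proof (rule indep_var_compose[OF indep_var_restrict[OF indep]])
      show "F \<in> borel_measurable (Pi\<^sub>M {..<i} (\<lambda>_. borel))"
        unfolding F_def
        by (intro borel_measurable_times borel_measurable_Max borel_measurable_prod
              measurable_component_singleton) auto
    qed (use i in auto)
    moreover have "F \<circ> (\<lambda>\<omega>. \<lambda>l\<in>{..<i}. Y l \<omega>) = (\<lambda>\<omega>. m i \<omega> * X i \<omega>)"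
      by (auto simp: F_def m_def X_def fun_eq_iff intro!: arg_cong2[where f="(*)"] arg_cong[where f=Max]
            image_cong prod.cong)
    moreover have "(\<lambda>y. y i - 1) \<circ> (\<lambda>\<omega>. \<lambda>l\<in>{i}. Y l \<omega>) = (\<lambda>\<omega>. Y i \<omega> - 1)"
      by auto
    ultimately have ind: "indep_var borel (\<lambda>\<omega>. m i \<omega> * X i \<omega>) borel (\<lambda>\<omega>. Y i \<omega> - 1)"
      by simp
    have int1: "integrable M (\<lambda>\<omega>. Y i \<omega> - 1)" using int_Y[OF i] by simp
    have eq: "m i \<omega> * (X (Suc i) \<omega> - X i \<omega>) = m i \<omega> * X i \<omega> * (Y i \<omega> - 1)" for \<omega>
      by (simp add: X_Suc)
    show "integrable M (\<lambda>\<omega>. m i \<omega> * (X (Suc i) \<omega> - X i \<omega>))"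
      unfolding eq by (rule indep_var_integrable[OF ind int_mX[OF i] int1])
    have "expectation (\<lambda>\<omega>. m i \<omega> * (X (Suc i) \<omega> - X i \<omega>))
        = expectation (\<lambda>\<omega>. m i \<omega> * X i \<omega>) * expectation (\<lambda>\<omega>. Y i \<omega> - 1)"
      unfolding eq by (rule indep_var_lebesgue_integral[OF ind int_mX[OF i] int1])
    moreover have "0 \<le> expectation (\<lambda>\<omega>. m i \<omega> * X i \<omega>)"
      using i m_ge[of i] X_nonneg[of i] by (intro Bochner_Integration.integral_nonneg) auto
    moreover have "expectation (\<lambda>\<omega>. Y i \<omega> - 1) = expectation (Y i) - 1"
      using int_Y[OF i] by (simp add: prob_space)
    ultimately show "0 \<le> expectation (\<lambda>\<omega>. m i \<omega> * (X (Suc i) \<omega> - X i \<omega>))"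
      using Y_mean[OF i] by simp
  qed
  have int_sum: "integrable M (\<lambda>\<omega>. \<Sum>i<n. m i \<omega> * (X (Suc i) \<omega> - X i \<omega>))"
    using incr(1) by (intro Bochner_Integration.integrable_sum) auto
  have "expectation (\<lambda>\<omega>. (m n \<omega>)\<^sup>2)
      \<le> expectation (\<lambda>\<omega>. 4 * (X n \<omega>)\<^sup>2 - 4 * (\<Sum>i<n. m i \<omega> * (X (Suc i) \<omega> - X i \<omega>)))"
    using int_m int_X int_sum doob_l2_pathwise[of "\<lambda>k. X k _" n]
    by (intro integral_mono) (auto simp: m_def)
  also have "\<dots> = 4 * expectation (\<lambda>\<omega>. (X n \<omega>)\<^sup>2)
      - 4 * (\<Sum>i<n. expectation (\<lambda>\<omega>. m i \<omega> * (X (Suc i) \<omega> - X i \<omega>)))"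
    using int_X int_sum incr(1) by (simp add: Bochner_Integration.integral_sum)
  also have "\<dots> \<le> 4 * expectation (\<lambda>\<omega>. (X n \<omega>)\<^sup>2)"
    using sum_nonneg[of "{..<n}", OF incr(2)] by simp
  also have "expectation (\<lambda>\<omega>. (X n \<omega>)\<^sup>2) = expectation (\<lambda>\<omega>. \<Prod>i<n. (Y i \<omega>)\<^sup>2)"
    by (simp add: X_def prod_power_distrib)
  also have "\<dots> = (\<Prod>i<n. expectation (\<lambda>\<omega>. (Y i \<omega>)\<^sup>2))"
  proof (rule indep_vars_lebesgue_integral)
    show "indep_vars (\<lambda>_. borel) (\<lambda>i \<omega>. (Y i \<omega>)\<^sup>2) {..<n}"
      by (rule indep_vars_compose2[OF indep]) auto
    show "integrable M (\<lambda>\<omega>. (Y i \<omega>)\<^sup>2)" if i: "i \<in> {..<n}" for i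
    proof (rule integrable_const_bound[of _ "B\<^sup>2"])
      show "AE \<omega> in M. norm ((Y i \<omega>)\<^sup>2) \<le> B\<^sup>2"
        using Y_nonneg[of i] Y_le[of i] i by (auto intro!: power_mono)
      show "(\<lambda>\<omega>. (Y i \<omega>)\<^sup>2) \<in> borel_measurable M"
        using i by (intro borel_measurable_power Y_meas) auto
    qed
  qed auto
  finally show "expectation (\<lambda>\<omega>. (Max ((\<lambda>k. X k \<omega>) ` {..n}))\<^sup>2)
      \<le> 4 * (\<Prod>i<n. expectation (\<lambda>\<omega>. (Y i \<omega>)\<^sup>2))"
    by (simp add: m_def)
qed

text \<open>Hoeffding's lemma on the interval from \<open>-c\<close> to \<open>c\<close>, whose
  width \<open>2 * c\<close> turns the constant 1/8 into 1/2.\<close>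

lemma expectation_exp_le:
  fixes Z :: "'a \<Rightarrow> real"
  assumes [measurable]: "Z \<in> borel_measurable M"
    and bound: "\<And>\<omega>. \<omega> \<in> space M \<Longrightarrow> \<bar>Z \<omega>\<bar> \<le> c"
    and mean: "expectation Z = 0" and l: "l > 0"
  shows "integrable M (\<lambda>\<omega>. exp (l * Z \<omega>))"
    and "expectation (\<lambda>\<omega>. exp (l * Z \<omega>)) \<le> exp (l\<^sup>2 * c\<^sup>2 / 2)"
proof -
  interpret interval_bounded_random_variable M Z "-c" c
    using bound by unfold_locales (auto simp: abs_le_iff minus_le_iff)
  show "integrable M (\<lambda>\<omega>. exp (l * Z \<omega>))"
  proof (rule integrable_const_bound[of _ "exp (l * c)"])
    show "AE \<omega> in M. norm (exp (l * Z \<omega>)) \<le> exp (l * c)"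
      using bound l by (auto simp: abs_le_iff)
  qed measurable
  then have "ennreal (expectation (\<lambda>\<omega>. exp (l * Z \<omega>))) = (\<integral>\<^sup>+\<omega>. ennreal (exp (l * Z \<omega>)) \<partial>M)"
    by (simp add: nn_integral_eq_integral)
  also have "\<dots> \<le> ennreal (exp (l\<^sup>2 * (c - - c)\<^sup>2 / 8))"
    by (rule Hoeffdings_lemma_nn_integral_0[OF l mean])
  also have "l\<^sup>2 * (c - - c)\<^sup>2 / 8 = l\<^sup>2 * c\<^sup>2 / 2"
    by (simp add: power2_eq_square)
  finally show "expectation (\<lambda>\<omega>. exp (l * Z \<omega>)) \<le> exp (l\<^sup>2 * c\<^sup>2 / 2)"
    by simp
qed

lemma expectation_max_exp_le:
  fixes Z :: "nat \<Rightarrow> 'a \<Rightarrow> real"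
  assumes indep: "indep_vars (\<lambda>_. borel) Z {..<n}"
    and bound: "\<And>i \<omega>. i < n \<Longrightarrow> \<omega> \<in> space M \<Longrightarrow> \<bar>Z i \<omega>\<bar> \<le> c"
    and mean: "\<And>i. i < n \<Longrightarrow> expectation (Z i) = 0" and l: "l > 0"
  shows "integrable M (\<lambda>\<omega>. MAX k\<in>{..n}. exp (l * (\<Sum>i<k. Z i \<omega>)))"
    and "expectation (\<lambda>\<omega>. MAX k\<in>{..n}. exp (l * (\<Sum>i<k. Z i \<omega>)))
           \<le> 4 * exp (real n * (l\<^sup>2 * c\<^sup>2 / 2))"
proof -
  \<comment> \<open>Half of the exponent, because Doob's inequality bounds the expected square of
    the maximum and squaring restores \<open>l\<close>.\<close>
  define Y where "Y i \<omega> = exp (l / 2 * Z i \<omega>)" for i \<omega>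
  have Z_meas[measurable]: "Z i \<in> borel_measurable M" if "i < n" for i
    using indep that by (auto simp: indep_vars_def)
  have indepY: "indep_vars (\<lambda>_. borel) Y {..<n}"
    unfolding Y_def by (rule indep_vars_compose2[OF indep]) auto
  have int_Z: "integrable M (Z i)" if "i < n" for i
  proof (rule integrable_const_bound[of _ c])
    show "AE \<omega> in M. norm (Z i \<omega>) \<le> c" using bound that by auto
  qed (use that in measurable)
  have Y_mean: "1 \<le> expectation (Y i)" if "i < n" for i
  proof -
    \<comment> \<open>The submartingale property of the products comes from
      \<open>1 + x \<le> exp x\<close> and the centring of \<open>Z i\<close>.\<close>
    have "expectation (\<lambda>\<omega>. 1 + l / 2 * Z i \<omega>) \<le> expectation (Y i)"
      unfolding Y_def using int_Z[OF that] expectation_exp_le(1)[of "Z i" c "l / 2"] bound[OF that] mean[OF that] l that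
      by (intro integral_mono) (auto intro!: exp_ge_add_one_self)
    then show ?thesis
      using int_Z[OF that] mean[OF that] by (simp add: prob_space)
  qed
  have *: "(Max ((\<lambda>k. \<Prod>i<k. Y i \<omega>) ` {..n}))\<^sup>2 = (MAX k\<in>{..n}. exp (l * (\<Sum>i<k. Z i \<omega>)))" for \<omega>
  proof -
    have Y: "(\<Prod>i<k. Y i \<omega>) = exp (l / 2 * (\<Sum>i<k. Z i \<omega>))" for k
      by (simp add: Y_def exp_sum sum_distrib_left)
    \<comment> \<open>Squaring is not monotone on all reals; cutting off at 0 first makes it so,
      hence it commutes with \<open>Max\<close>. The cut-off then disappears since the products are
      positive.\<close>
    have "(MAX k\<in>{..n}. exp (l * (\<Sum>i<k. Z i \<omega>)))
        = (MAX y\<in>(\<lambda>k. \<Prod>i<k. Y i \<omega>) ` {..n}. (max 0 y)\<^sup>2)"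
      by (simp add: image_image Y power2_eq_square flip: exp_add)
    also have "\<dots> = (max 0 (Max ((\<lambda>k. \<Prod>i<k. Y i \<omega>) ` {..n})))\<^sup>2"
      by (rule mono_Max_commute[symmetric]) (auto intro!: monoI power_mono)
    also have "max 0 (Max ((\<lambda>k. \<Prod>i<k. Y i \<omega>) ` {..n})) = Max ((\<lambda>k. \<Prod>i<k. Y i \<omega>) ` {..n})"
      by (intro max_absorb2) (auto simp: Max_ge_iff Y intro!: bexI[of _ 0])
    finally show ?thesis by simp
  qed
  have Y_pos: "0 \<le> Y i \<omega>" for i \<omega> by (simp add: Y_def)
  have Y_le: "Y i \<omega> \<le> exp (l / 2 * c)" if "i < n" "\<omega> \<in> space M" for i \<omega>
    unfolding Y_def using l bound[OF that] by (auto simp: abs_le_iff)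
  note max = expectation_max_prod_square_le[OF indepY Y_pos Y_le Y_mean, unfolded *]
  show "integrable M (\<lambda>\<omega>. MAX k\<in>{..n}. exp (l * (\<Sum>i<k. Z i \<omega>)))"
    by (rule max(1))
  have "(\<Prod>i<n. expectation (\<lambda>\<omega>. (Y i \<omega>)\<^sup>2)) \<le> (\<Prod>i<n. exp (l\<^sup>2 * c\<^sup>2 / 2))"
  proof (intro prod_mono conjI)
    fix i assume "i \<in> {..<n}"
    then have i: "i < n" by simp
    have "(Y i \<omega>)\<^sup>2 = exp (l * Z i \<omega>)" for \<omega>
      by (simp add: Y_def power2_eq_square flip: exp_add)
    then show "expectation (\<lambda>\<omega>. (Y i \<omega>)\<^sup>2) \<le> exp (l\<^sup>2 * c\<^sup>2 / 2)"
      using expectation_exp_le(2)[of "Z i" c l] bound[OF i] mean[OF i] l i by simp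
  qed (auto intro!: Bochner_Integration.integral_nonneg)
  then show "expectation (\<lambda>\<omega>. MAX k\<in>{..n}. exp (l * (\<Sum>i<k. Z i \<omega>)))
      \<le> 4 * exp (real n * (l\<^sup>2 * c\<^sup>2 / 2))"
    using max(2) unfolding exp_of_nat_mult by simp
qed

text \<open>Apply the exponential bound to \<open>Z\<close> and to \<open>- Z\<close> with
  \<open>l = 1 / \<sigma>\<close>: each contributes at most 8, and together they dominate the
  exponential of the maximal absolute sum divided by \<open>\<sigma>\<close>.\<close>

lemma expectation_max_sum_powr_le:
  fixes Z :: "nat \<Rightarrow> 'a \<Rightarrow> real"
  assumes indep: "indep_vars (\<lambda>_. borel) Z {..<n}"
    and bound: "\<And>i \<omega>. i < n \<Longrightarrow> \<omega> \<in> space M \<Longrightarrow> \<bar>Z i \<omega>\<bar> \<le> c"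
    and mean: "\<And>i. i < n \<Longrightarrow> expectation (Z i) = 0"
    and \<sigma>: "\<sigma> > 0" "real n * c\<^sup>2 \<le> \<sigma>\<^sup>2" and p: "p > 0"
  shows "integrable M (\<lambda>\<omega>. (MAX k\<in>{..n}. \<bar>\<Sum>i<k. Z i \<omega>\<bar>) powr p)"
    and "expectation (\<lambda>\<omega>. (MAX k\<in>{..n}. \<bar>\<Sum>i<k. Z i \<omega>\<bar>) powr p) \<le> 16 * (p * \<sigma>) powr p"
proof -
  define S where "S k \<omega> = (\<Sum>i<k. Z i \<omega>)" for k \<omega>
  define R where "R \<omega> = (MAX k\<in>{..n}. \<bar>S k \<omega>\<bar>)" for \<omega>
  define E1 where "E1 \<omega> = (MAX k\<in>{..n}. exp (1 / \<sigma> * (\<Sum>i<k. Z i \<omega>)))" for \<omega>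
  define E2 where "E2 \<omega> = (MAX k\<in>{..n}. exp (1 / \<sigma> * (\<Sum>i<k. - Z i \<omega>)))" for \<omega>
  have indep': "indep_vars (\<lambda>_. borel) (\<lambda>i \<omega>. - Z i \<omega>) {..<n}"
    by (rule indep_vars_compose2[OF indep]) auto
  have l: "1 / \<sigma> > 0" using \<sigma> by simp
  \<comment> \<open>The scale \<open>\<sigma>\<close> is chosen so that the exponent is at most
    1/2.\<close>
  have *: "4 * exp (real n * ((1 / \<sigma>)\<^sup>2 * c\<^sup>2 / 2)) \<le> 8"
  proof -
    have "real n * ((1 / \<sigma>)\<^sup>2 * c\<^sup>2 / 2) \<le> 1 / 2"
      using \<sigma> by (simp add: power_divide field_simps)
    then have "exp (real n * ((1 / \<sigma>)\<^sup>2 * c\<^sup>2 / 2)) \<le> exp (1 / 2)" by simp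
    also have "\<dots> \<le> 2" using exp_half_le2 by simp
    finally show ?thesis by simp
  qed
  have Z_meas[measurable]: "Z i \<in> borel_measurable M" if "i < n" for i
    using indep that by (auto simp: indep_vars_def)
  have R_meas[measurable]: "R \<in> borel_measurable M"
    unfolding R_def S_def by (intro borel_measurable_Max borel_measurable_abs borel_measurable_sum) auto
  have E1: "integrable M E1" "expectation E1 \<le> 8"
    using expectation_max_exp_le[OF indep bound mean l] *
    unfolding E1_def by (force, linarith)
  have E2: "integrable M E2" "expectation E2 \<le> 8"
    using expectation_max_exp_le[OF indep' _ _ l, of c] bound mean *
    unfolding E2_def by (force, force)
  have R_nonneg: "0 \<le> R \<omega>" for \<omega>
    by (auto simp: R_def Max_ge_iff)
  have le: "R \<omega> powr p \<le> (p * \<sigma>) powr p * (E1 \<omega> + E2 \<omega>)" for \<omega>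
  proof -
    \<comment> \<open>At an index attaining the maximum, the sign of the sum decides which of
      \<open>E1\<close> and \<open>E2\<close> carries the bound; the other is nonnegative.\<close>
    have "R \<omega> \<in> (\<lambda>k. \<bar>S k \<omega>\<bar>) ` {..n}"
      unfolding R_def by (rule Max_in) auto
    then obtain k where k: "k \<le> n" "R \<omega> = \<bar>S k \<omega>\<bar>" by auto
    have "exp (1 / \<sigma> * S k \<omega>) \<le> E1 \<omega>" "exp (1 / \<sigma> * (- S k \<omega>)) \<le> E2 \<omega>"
      unfolding E1_def E2_def S_def using k by (auto intro!: Max_ge simp: sum_negf)
    moreover have "0 \<le> exp (1 / \<sigma> * S k \<omega>)" "0 \<le> exp (1 / \<sigma> * (- S k \<omega>))" by simp_all
    ultimately have exp_le: "exp (R \<omega> / \<sigma>) \<le> E1 \<omega> + E2 \<omega>"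
      unfolding k by (cases "0 \<le> S k \<omega>"; simp del: exp_ge_zero)
    have "R \<omega> powr p = \<sigma> powr p * (R \<omega> / \<sigma>) powr p"
      using \<sigma> R_nonneg by (simp add: powr_divide)
    also have "\<dots> \<le> \<sigma> powr p * (p powr p * exp (R \<omega> / \<sigma>))"
      using R_nonneg \<sigma> p by (intro mult_left_mono powr_le_exp) auto
    also have "\<dots> \<le> \<sigma> powr p * (p powr p * (E1 \<omega> + E2 \<omega>))"
      by (intro mult_left_mono) (use exp_le in auto)
    finally show ?thesis using \<sigma> p by (simp add: powr_mult mult_ac)
  qed
  have int: "integrable M (\<lambda>\<omega>. (p * \<sigma>) powr p * (E1 \<omega> + E2 \<omega>))"
    using E1 E2 by simp
  have int_R: "integrable M (\<lambda>\<omega>. R \<omega> powr p)"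
    by (rule Bochner_Integration.integrable_bound[OF int])
       (use le in \<open>auto intro!: AE_I2 order_trans[OF le abs_ge_self]\<close>)
  then show "integrable M (\<lambda>\<omega>. (MAX k\<in>{..n}. \<bar>\<Sum>i<k. Z i \<omega>\<bar>) powr p)"
    by (simp add: R_def S_def)
  have "expectation (\<lambda>\<omega>. R \<omega> powr p) \<le> expectation (\<lambda>\<omega>. (p * \<sigma>) powr p * (E1 \<omega> + E2 \<omega>))"
    by (intro integral_mono int_R int le)
  also have "\<dots> = (p * \<sigma>) powr p * (expectation E1 + expectation E2)"
    using E1 E2 by simp
  also have "\<dots> \<le> (p * \<sigma>) powr p * 16"
    using E1 E2 by (intro mult_left_mono) auto
  finally show "expectation (\<lambda>\<omega>. (MAX k\<in>{..n}. \<bar>\<Sum>i<k. Z i \<omega>\<bar>) powr p) \<le> 16 * (p * \<sigma>) powr p"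
    by (simp add: R_def S_def mult.commute)
qed

end

section \<open>Reindexing of independent families, completed measures and the uniform law\<close>

lemma (in prob_space) indep_vars_reindex_inj:
  assumes inj: "inj_on f I" and indep: "indep_vars M' X (f ` I)"
  shows "indep_vars (\<lambda>i. M' (f i)) (\<lambda>i. X (f i)) I"
proof -
  have "indep_sets (\<lambda>i. F (f i)) I" if F: "indep_sets F (f ` I)" for F
  proof (rule indep_setsI)
    show "F (f i) \<subseteq> events" if "i \<in> I" for i
      using F that by (auto simp: indep_sets_def)
    fix A J assume J: "J \<noteq> {}" "J \<subseteq> I" "finite J" and A: "\<forall>j\<in>J. A j \<in> F (f j)"
    define A' where "A' = A \<circ> the_inv_into I f"
    have A': "A' (f j) = A j" if "j \<in> J" for j
      using that J inj by (auto simp: A'_def the_inv_into_f_f)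
    have "prob (\<Inter>j\<in>f ` J. A' j) = (\<Prod>j\<in>f ` J. prob (A' j))"
      using J A by (intro indep_setsD[OF F]) (auto simp: A')
    then show "prob (\<Inter>j\<in>J. A j) = (\<Prod>j\<in>J. prob (A j))"
      using inj_on_subset[OF inj J(2)] by (simp add: prod.reindex A')
  qed
  then show ?thesis
    using indep unfolding indep_vars_def by auto
qed

text \<open>Preimages under \<open>f\<close> and \<open>g\<close> differ by a null set, and the
  completion measures all of these.\<close>

lemma borel_measurable_completion_AE:
  assumes f: "f \<in> borel_measurable M" and ae: "AE x in M. f x = g x"
  shows "g \<in> borel_measurable (completion M)"
proof (rule measurableI)
  fix A :: "'b set" assume A: "A \<in> sets borel"
  show "g -` A \<inter> space (completion M) \<in> sets (completion M)"
  proof (rule completion.in_sets_AE)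
    show "AE x in completion M. x \<in> f -` A \<inter> space M \<longleftrightarrow> x \<in> g -` A \<inter> space (completion M)"
      using AE_completion[OF ae] by eventually_elim auto
    show "f -` A \<inter> space M \<in> sets (completion M)"
      using measurable_sets[OF f A] by simp
  qed auto
qed auto

text \<open>\<open>X'\<close> supplies the measurability of \<open>X\<close>, and the majorant
  \<open>Y\<close> supplies both integrability and the size of the norm.\<close>

lemma in_Lp_Lp_norm_le:
  assumes "X' \<in> borel_measurable M" "AE \<omega> in M. X' \<omega> = X \<omega>"
    and Y: "integrable M Y" "AE \<omega> in M. \<bar>X \<omega>\<bar> powr p \<le> Y \<omega>"
    and p: "p > 0" and c: "c \<ge> 0" "integral\<^sup>L M Y \<le> c powr p"
  shows "in_Lp M p X" and "Lp_norm M p X \<le> c"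
proof -
  have X[measurable]: "X \<in> borel_measurable (completion M)"
    using assms by (intro borel_measurable_completion_AE)
  have Y': "integrable (completion M) Y"
    using Y by (simp add: integrable_completion)
  have le: "AE \<omega> in completion M. \<bar>X \<omega>\<bar> powr p \<le> Y \<omega>"
    using Y by (intro AE_completion)
  have int: "integrable (completion M) (\<lambda>\<omega>. \<bar>X \<omega>\<bar> powr p)"
    by (rule Bochner_Integration.integrable_bound[OF Y']) (use le in auto)
  then show "in_Lp M p X" by (simp add: in_Lp_def)
  have "(\<integral>\<omega>. \<bar>X \<omega>\<bar> powr p \<partial>completion M) \<le> integral\<^sup>L (completion M) Y"
    by (intro integral_mono_AE int Y' le)
  also have "\<dots> \<le> c powr p"
    using Y c by (simp add: integral_completion)
  finally have "Lp_norm M p X \<le> (c powr p) powr (1 / p)"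
    unfolding Lp_norm_def using p by (intro powr_mono2) (auto intro!: Bochner_Integration.integral_nonneg)
  then show "Lp_norm M p X \<le> c"
    using p c by (simp add: powr_powr)
qed

text \<open>The open interval may be closed, as two points are null; the closed one fits the
  fundamental theorem of calculus.\<close>

lemma (in prob_space) expectation_uniform:
  fixes F :: "real \<Rightarrow> 'b::{banach, second_countable_topology}"
  assumes X: "X \<in> borel_measurable M"
    and distr: "distr M lborel X = uniform_measure lborel {0<..<1}"
    and F: "F \<in> borel_measurable borel"
  shows "expectation (\<lambda>\<omega>. F (X \<omega>)) = (\<integral>x. indicator {0..1} x *\<^sub>R F x \<partial>lborel)"
proof -
  have "expectation (\<lambda>\<omega>. F (X \<omega>)) = integral\<^sup>L (distr M lborel X) F"
    using X F by (intro integral_distr[symmetric]) auto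
  also have "\<dots> = integral\<^sup>L (density lborel (\<lambda>x. ennreal (indicator {0<..<1} x))) F"
    by (simp add: distr uniform_measure_def ennreal_indicator divide_ennreal_def)
  also have "\<dots> = (\<integral>x. indicator {0<..<1} x *\<^sub>R F x \<partial>lborel)"
    using F by (intro integral_density) auto
  also have "\<dots> = (\<integral>x. indicator {0..1} x *\<^sub>R F x \<partial>lborel)"
  proof (rule integral_cong_AE)
    show "AE x in lborel. indicator {0<..<1} x *\<^sub>R F x = indicator {0..1} x *\<^sub>R F x"
      using AE_lborel_singleton[of 0] AE_lborel_singleton[of 1]
      by eventually_elim (auto simp: indicator_def)
  qed (use F in measurable)
  finally show ?thesis .
qed

lemma (in prob_space) AE_uniform:
  assumes X: "X \<in> borel_measurable M"
    and distr: "distr M lborel X = uniform_measure lborel {0<..<1}"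
  shows "AE \<omega> in M. X \<omega> \<in> {0<..<1::real}"
proof -
  have "AE x in uniform_measure lborel {0<..<1::real}. x \<in> {0<..<1}"
    by (intro AE_uniform_measureI) auto
  then have "AE x in distr M lborel X. x \<in> {0<..<1}"
    by (simp only: distr)
  then show ?thesis
    using X by (subst (asm) AE_distr_iff) auto
qed

subsection \<open>Pathwise error analysis\<close>

text \<open>The sequence \<open>a * (1 + b) ^ n\<close> satisfies the recursion with equality, as a
  geometric sum, so strong induction compares \<open>e\<close> with it.\<close>

lemma discrete_gronwall:
  fixes e :: "nat \<Rightarrow> real"
  assumes "b \<ge> 0" and "\<And>n. n \<le> N \<Longrightarrow> e n \<le> a + b * (\<Sum>j<n. e j)" and "n \<le> N"
  shows "e n \<le> a * (1 + b) ^ n"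
  using \<open>n \<le> N\<close>
proof (induction n rule: less_induct)
  case (less n)
  have geom: "a + b * (\<Sum>j<n. a * (1 + b) ^ j) = a * (1 + b) ^ n" for n
    by (induction n) (simp_all add: algebra_simps)
  have "e n \<le> a + b * (\<Sum>j<n. e j)"
    using assms less by blast
  also have "\<dots> \<le> a + b * (\<Sum>j<n. a * (1 + b) ^ j)"
    using less assms by (intro add_left_mono mult_left_mono sum_mono) auto
  finally show ?case by (simp only: geom)
qed

locale hoelder_ivp =
  fixes T \<gamma> L K :: real
    and u\<^sub>0 :: "'v::euclidean_space"
    and f :: "real \<Rightarrow> 'v \<Rightarrow> 'v" and u :: "real \<Rightarrow> 'v"
  assumes T_pos: "T > 0"
    and \<gamma>: "0 < \<gamma>" "\<gamma> \<le> 1"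
    and f_cont: "continuous_on ({0..T} \<times> UNIV) (\<lambda>(t, x). f t x)"
    and L_pos: "L > 0" and K_pos: "K > 0"
    and f_lipschitz: "\<And>t x\<^sub>1 x\<^sub>2. t \<in> {0..T} \<Longrightarrow> norm (f t x\<^sub>1 - f t x\<^sub>2) \<le> L * norm (x\<^sub>1 - x\<^sub>2)"
    and f_hoelder: "\<And>t\<^sub>1 t\<^sub>2 x. t\<^sub>1 \<in> {0..T} \<Longrightarrow> t\<^sub>2 \<in> {0..T} \<Longrightarrow>
           norm (f t\<^sub>1 x - f t\<^sub>2 x) \<le> K * (1 + norm x) * \<bar>t\<^sub>1 - t\<^sub>2\<bar> powr \<gamma>"
    and solution: "solves_ivp T f u\<^sub>0 u"
begin

section \<open>Regularity of the exact solution\<close>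

definition g :: "real \<Rightarrow> 'v" where
  "g t = f t (u t)"

lemma u_0: "u 0 = u\<^sub>0"
  and u_deriv: "t \<in> {0..T} \<Longrightarrow> (u has_vector_derivative g t) (at t within {0..T})"
  using solution by (auto simp: solves_ivp_def g_def)

lemma u_cont: "continuous_on {0..T} u"
  using u_deriv by (rule continuous_on_vector_derivative)

lemma g_cont: "continuous_on {0..T} g"
  using continuous_on_compose2[OF f_cont, of "{0..T}" "\<lambda>t. (t, u t)"] u_cont
  by (simp add: g_def continuous_on_Pair image_subset_iff)

lemma g_bounded:
  obtains B where "B > 0" "\<And>t. t \<in> {0..T} \<Longrightarrow> norm (g t) \<le> B"
proof -
  have "bounded (g ` {0..T})"
    by (intro compact_imp_bounded compact_continuous_image g_cont) simp
  then obtain B where "B > 0" "\<forall>x\<in>g ` {0..T}. norm x \<le> B"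
    unfolding bounded_pos by blast
  then show ?thesis
    by (intro that[of B]) auto
qed

lemma u_lipschitz:
  assumes "\<And>t. t \<in> {0..T} \<Longrightarrow> norm (g t) \<le> B" "s \<in> {0..T}" "t \<in> {0..T}"
  shows "norm (u t - u s) \<le> B * \<bar>t - s\<bar>"
proof -
  have "norm (u t - u s) \<le> B * norm (t - s)"
  proof (rule differentiable_bound[where S = "{0..T}" and f' = "\<lambda>t x. x *\<^sub>R g t"])
    show "(u has_derivative (\<lambda>x. x *\<^sub>R g x')) (at x' within {0..T})" if "x' \<in> {0..T}" for x'
      using u_deriv[OF that] by (simp add: has_vector_derivative_def)
    show "onorm (\<lambda>x. x *\<^sub>R g x') \<le> B" if "x' \<in> {0..T}" for x'
      using assms(1)[OF that] by (intro onorm_le) (simp add: mult.commute[of B] mult_left_mono)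
  qed (use assms in auto)
  then show ?thesis by simp
qed

text \<open>Change the state first and then the time. The first change is Lipschitz in time, which
  \<open>\<bar>t - s\<bar> \<le> 1\<close> weakens to order \<open>\<gamma>\<close>; in the second
  the factor \<open>1 + norm x\<close> is bounded because \<open>u\<close> is.\<close>

lemma g_hoelder:
  obtains C where "C > 0"
    "\<And>s t. s \<in> {0..T} \<Longrightarrow> t \<in> {0..T} \<Longrightarrow> \<bar>t - s\<bar> \<le> 1 \<Longrightarrow> norm (g t - g s) \<le> C * \<bar>t - s\<bar> powr \<gamma>"
proof -
  obtain B where B: "B > 0" "\<And>t. t \<in> {0..T} \<Longrightarrow> norm (g t) \<le> B"
    by (rule g_bounded) blast
  have "bounded (u ` {0..T})"
    by (intro compact_imp_bounded compact_continuous_image u_cont) simp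
  then obtain A where A: "A > 0" "\<And>t. t \<in> {0..T} \<Longrightarrow> norm (u t) \<le> A"
    by (auto simp: bounded_pos)
  have "norm (g t - g s) \<le> (L * B + K * (1 + A)) * \<bar>t - s\<bar> powr \<gamma>"
    if st: "s \<in> {0..T}" "t \<in> {0..T}" "\<bar>t - s\<bar> \<le> 1" for s t
  proof -
    have le: "\<bar>t - s\<bar> \<le> \<bar>t - s\<bar> powr \<gamma>"
    proof (cases "t = s")
      case False
      then show ?thesis
        using st \<gamma> powr_mono'[of \<gamma> 1 "\<bar>t - s\<bar>"] by simp
    qed simp
    have "norm (g t - g s) \<le> norm (f t (u t) - f t (u s)) + norm (f t (u s) - f s (u s))"
      unfolding g_def by (rule norm_diff_triangle_le[OF order_refl order_refl])
    also have "norm (f t (u t) - f t (u s)) \<le> L * norm (u t - u s)"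
      using st by (intro f_lipschitz)
    also have "norm (u t - u s) \<le> B * \<bar>t - s\<bar>"
      using B(2) st(1,2) by (rule u_lipschitz)
    also have "\<bar>t - s\<bar> \<le> \<bar>t - s\<bar> powr \<gamma>" by (rule le)
    also have "norm (f t (u s) - f s (u s)) \<le> K * (1 + norm (u s)) * \<bar>t - s\<bar> powr \<gamma>"
      using st by (intro f_hoelder)
    also have "norm (u s) \<le> A" using A st by simp
    finally show ?thesis
      using L_pos B K_pos by (simp add: algebra_simps mult_right_mono mult_left_mono)
  qed
  moreover have "L * B + K * (1 + A) > 0"
    using L_pos K_pos A B by (simp add: add_pos_pos)
  ultimately show ?thesis using that by blast
qed

text \<open>The derivative of \<open>u\<close> differs from the constant \<open>g r\<close> by at
  most \<open>C * h powr \<gamma>\<close> on the interval. Leaving \<open>r\<close>,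
  \<open>s\<close>, \<open>t\<close> free covers both the quadrature over a full step and the Euler
  predictor, where \<open>r = s\<close> is the left end.\<close>

lemma local_defect:
  assumes C: "\<And>s t. s \<in> {0..T} \<Longrightarrow> t \<in> {0..T} \<Longrightarrow> \<bar>t - s\<bar> \<le> 1
      \<Longrightarrow> norm (g t - g s) \<le> C * \<bar>t - s\<bar> powr \<gamma>" "C > 0"
    and ab: "{a..a + h} \<subseteq> {0..T}" "h \<le> 1" and in_ab: "r \<in> {a..a + h}" "s \<in> {a..a + h}" "t \<in> {a..a + h}"
  shows "norm (u t - u s - (t - s) *\<^sub>R g r) \<le> C * h powr (1 + \<gamma>)"
proof -
  have h: "h \<ge> 0" using in_ab by auto
  have "norm (u t - u s - (t - s) *\<^sub>R g r) \<le> norm (t - s) * (C * h powr \<gamma>)"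
  proof (rule vector_differentiable_bound_linearization[where S = "{a..a + h}"])
    show "(u has_vector_derivative g x) (at x within {a..a + h})" if "x \<in> {a..a + h}" for x
      using u_deriv[of x] that ab by (meson has_vector_derivative_within_subset subsetD)
    show "closed_segment s t \<subseteq> {a..a + h}"
      using in_ab by (auto simp: closed_segment_eq_real_ivl split: if_splits)
    show "norm (g x - g r) \<le> C * h powr \<gamma>" if "x \<in> {a..a + h}" for x
    proof -
      have *: "\<bar>x - r\<bar> \<le> h" "x \<in> {0..T}" "r \<in> {0..T}" using that in_ab ab by auto
      then have "norm (g x - g r) \<le> C * \<bar>x - r\<bar> powr \<gamma>"
        using C(1)[of r x] ab by auto
      also have "\<dots> \<le> C * h powr \<gamma>"
        using * \<gamma> C by (intro mult_left_mono powr_mono2) auto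
      finally show ?thesis .
    qed
  qed (use in_ab in auto)
  also have "\<dots> \<le> h * (C * h powr \<gamma>)"
    using in_ab C by (intro mult_right_mono) auto
  finally show ?thesis
    using h by (simp add: powr_add mult_ac)
qed

section \<open>Quadrature defects and their propagation through the schemes\<close>

definition defect :: "real \<Rightarrow> nat \<Rightarrow> real \<Rightarrow> 'v" where
  "defect h j s = h *\<^sub>R g (real j * h + s * h) - (u (real (Suc j) * h) - u (real j * h))"

lemma stage_times:
  assumes "0 < h" "real N * h \<le> T" "j < N" "s \<in> {0..1}"
  shows "{real j * h..real j * h + h} \<subseteq> {0..T}"
    and "real j * h + s * h \<in> {real j * h..real j * h + h}"
    and "real j * h + s * h \<in> {0..T}"
proof -
  have "real (Suc j) * h \<le> real N * h"
    using assms by (intro mult_right_mono) auto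
  then have "real j * h + h \<le> T" using assms by (simp add: algebra_simps)
  moreover have "s * h \<le> 1 * h" using assms by (intro mult_right_mono) auto
  ultimately show 1: "{real j * h..real j * h + h} \<subseteq> {0..T}"
    and 2: "real j * h + s * h \<in> {real j * h..real j * h + h}"
    using assms by auto
  show "real j * h + s * h \<in> {0..T}"
    using 1 2 by (rule subsetD)
qed

lemma norm_defect_le:
  assumes C: "\<And>s t. s \<in> {0..T} \<Longrightarrow> t \<in> {0..T} \<Longrightarrow> \<bar>t - s\<bar> \<le> 1
      \<Longrightarrow> norm (g t - g s) \<le> C * \<bar>t - s\<bar> powr \<gamma>" "C > 0"
    and h: "0 < h" "h \<le> 1" "real N * h \<le> T" "j < N" "s \<in> {0..1}"
  shows "norm (defect h j s) \<le> C * h powr (1 + \<gamma>)"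
  using local_defect[OF C stage_times(1)[OF h(1,3,4,5)] h(2) stage_times(2)[OF h(1,3,4,5)],
      of "real j * h" "real (Suc j) * h"] h
  by (simp add: defect_def algebra_simps norm_minus_commute)

text \<open>Treats both schemes at once: \<open>W\<close> is the stage value at which
  \<open>f\<close> is evaluated, and \<open>q\<close>, \<open>r\<close> describe how its error
  depends on the error at the preceding node.\<close>

lemma one_step_error:
  fixes V W :: "nat \<Rightarrow> 'v"
  assumes h: "0 < h" "real N * h \<le> T"
    and \<theta>: "\<And>j. j < N \<Longrightarrow> \<theta> (Suc j) \<in> {0..1}"
    and V: "V 0 = u\<^sub>0"
      "\<And>j. j < N \<Longrightarrow> V (Suc j) = V j + h *\<^sub>R f (real j * h + \<theta> (Suc j) * h) (W j)"
    and W: "\<And>j. j < N \<Longrightarrow>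
      norm (u (real j * h + \<theta> (Suc j) * h) - W j) \<le> q * norm (u (real j * h) - V j) + r"
    and q: "q \<ge> 0" "r \<ge> 0"
    and R: "\<And>n. n \<le> N \<Longrightarrow> norm (\<Sum>j<n. defect h j (\<theta> (Suc j))) \<le> R"
    and n: "n \<le> N"
  shows "norm (u (real n * h) - V n) \<le> exp (L * q * T) * (T * L * r + R)"
proof -
  define e where "e n = norm (u (real n * h) - V n)" for n
  define G where "G j = g (real j * h + \<theta> (Suc j) * h) - f (real j * h + \<theta> (Suc j) * h) (W j)" for j
  have R0: "R \<ge> 0" using R[of 0] by simp
  \<comment> \<open>The errors telescope. The defects stay inside one sum, so that their
    cancellation is not lost to the triangle inequality.\<close>
  have e_eq: "u (real n * h) - V n = h *\<^sub>R (\<Sum>j<n. G j) - (\<Sum>j<n. defect h j (\<theta> (Suc j)))"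
    if "n \<le> N" for n
    using that
  proof (induction n)
    case (Suc n)
    then show ?case by (simp add: V G_def defect_def algebra_simps)
  qed (simp add: u_0 V)
  have G_le: "norm (G j) \<le> L * (q * e j + r)" if "j < N" for j
  proof -
    have "norm (G j) \<le> L * norm (u (real j * h + \<theta> (Suc j) * h) - W j)"
      unfolding G_def g_def using stage_times(3)[OF h that \<theta>[OF that]] by (intro f_lipschitz) auto
    also have "\<dots> \<le> L * (q * e j + r)"
      unfolding e_def using W[OF that] L_pos by (intro mult_left_mono) auto
    finally show ?thesis .
  qed
  have "e n \<le> (T * L * r + R) + (h * L * q) * (\<Sum>j<n. e j)" if "n \<le> N" for n
  proof -
    have "e n \<le> norm (h *\<^sub>R (\<Sum>j<n. G j)) + norm (\<Sum>j<n. defect h j (\<theta> (Suc j)))"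
      unfolding e_def e_eq[OF that] by (rule norm_triangle_ineq4)
    also have "norm (h *\<^sub>R (\<Sum>j<n. G j)) \<le> h * (\<Sum>j<n. L * (q * e j + r))"
      using h G_le that by (auto intro!: mult_left_mono order_trans[OF norm_sum] sum_mono)
    also have "\<dots> = (real n * h) * (L * r) + (h * L * q) * (\<Sum>j<n. e j)"
      by (simp add: sum.distrib algebra_simps flip: sum_distrib_left)
    also have "real n * h \<le> T"
      using h that mult_right_mono[of "real n" "real N" h] by linarith
    also have "norm (\<Sum>j<n. defect h j (\<theta> (Suc j))) \<le> R" using R[OF that] .
    finally show ?thesis using L_pos q by (simp add: mult_ac mult_right_mono add_ac)
  qed
  then have "e n \<le> (T * L * r + R) * (1 + h * L * q) ^ n"
    using n h L_pos q by (intro discrete_gronwall) auto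
  also have "\<dots> \<le> (T * L * r + R) * exp (L * q * T)"
  proof (rule mult_left_mono)
    have "(1 + h * L * q) ^ n \<le> exp (h * L * q) ^ n"
      using h L_pos q by (intro power_mono exp_ge_add_one_self) auto
    also have "\<dots> = exp (L * q * (real n * h))"
      by (simp add: exp_of_nat_mult[symmetric] mult_ac)
    also have "\<dots> \<le> exp (L * q * T)"
    proof -
      have "real n * h \<le> T"
        using h n mult_right_mono[of "real n" "real N" h] by linarith
      then show ?thesis using L_pos q by (simp add: mult_left_mono)
    qed
    finally show "(1 + h * L * q) ^ n \<le> exp (L * q * T)" .
  qed (use L_pos q T_pos R0 in auto)
  finally show ?thesis
    by (simp add: e_def mult.commute)
qed

text \<open>The stage value is the node value itself, so \<open>q = 1\<close>;
  \<open>r = B * h\<close> is the motion of \<open>u\<close> within the step.\<close>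

lemma rand_euler_error:
  assumes B: "\<And>t. t \<in> {0..T} \<Longrightarrow> norm (g t) \<le> B" "B > 0"
    and h: "0 < h" "real N * h \<le> T"
    and \<theta>: "\<And>j. j < N \<Longrightarrow> \<theta> (Suc j) \<in> {0..1}"
    and R: "\<And>n. n \<le> N \<Longrightarrow> norm (\<Sum>j<n. defect h j (\<theta> (Suc j))) \<le> R"
    and n: "n \<le> N"
  shows "norm (u (real n * h) - rand_euler f u\<^sub>0 h \<theta> n) \<le> exp (L * T) * (T * L * (B * h) + R)"
proof -
  have "norm (u (real n * h) - rand_euler f u\<^sub>0 h \<theta> n) \<le> exp (L * 1 * T) * (T * L * (B * h) + R)"
  proof (rule one_step_error[where W = "rand_euler f u\<^sub>0 h \<theta>", OF h \<theta> _ _ _ _ _ R n])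
    fix j assume j: "j < N"
    let ?a = "real j * h" and ?t = "real j * h + \<theta> (Suc j) * h" and ?V = "rand_euler f u\<^sub>0 h \<theta> j"
    have mem: "?t \<in> {0..T}" "?a \<in> {0..T}"
      using stage_times(3)[OF h j \<theta>[OF j]] stage_times(3)[OF h j, of 0] by auto
    have "norm (u ?t - ?V) \<le> norm (u ?t - u ?a) + norm (u ?a - ?V)"
      by (rule norm_diff_triangle_le[OF order_refl order_refl])
    also have "norm (u ?t - u ?a) \<le> B * \<bar>?t - ?a\<bar>"
      using B(1) mem(2,1) by (rule u_lipschitz)
    also have "\<bar>?t - ?a\<bar> \<le> h"
      using \<theta>[OF j] h by (simp add: abs_mult mult_left_le_one_le)
    finally show "norm (u ?t - ?V) \<le> 1 * norm (u ?a - ?V) + B * h"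
      using B by simp
  qed (use B h in auto)
  then show ?thesis by simp
qed

text \<open>The stage value is an Euler predictor: its linearization error gives
  \<open>r = C * h powr (1 + \<gamma>)\<close>, and the Lipschitz bound over a time of at most 1
  gives \<open>q = 1 + L\<close>.\<close>

lemma rand_rk_error:
  assumes C: "\<And>s t. s \<in> {0..T} \<Longrightarrow> t \<in> {0..T} \<Longrightarrow> \<bar>t - s\<bar> \<le> 1
      \<Longrightarrow> norm (g t - g s) \<le> C * \<bar>t - s\<bar> powr \<gamma>" "C > 0"
    and h: "0 < h" "h \<le> 1" "real N * h \<le> T"
    and \<theta>: "\<And>j. j < N \<Longrightarrow> \<theta> (Suc j) \<in> {0..1}"
    and R: "\<And>n. n \<le> N \<Longrightarrow> norm (\<Sum>j<n. defect h j (\<theta> (Suc j))) \<le> R"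
    and n: "n \<le> N"
  shows "norm (u (real n * h) - rand_rk f u\<^sub>0 h \<theta> n)
    \<le> exp (L * (1 + L) * T) * (T * L * (C * h powr (1 + \<gamma>)) + R)"
proof -
  let ?V = "rand_rk f u\<^sub>0 h \<theta>"
  let ?W = "\<lambda>j. ?V j + (h * \<theta> (Suc j)) *\<^sub>R f (real j * h) (?V j)"
  show ?thesis
  proof (rule one_step_error[where W = ?W, OF h(1,3) \<theta> _ _ _ _ _ R n])
    fix j assume j: "j < N"
    let ?a = "real j * h" and ?t = "real j * h + \<theta> (Suc j) * h"
    have s: "0 \<le> h * \<theta> (Suc j)" "h * \<theta> (Suc j) \<le> 1"
      using \<theta>[OF j] h by (auto intro: mult_le_one)
    have a: "?a \<in> {0..T}"
      using stage_times(3)[OF h(1,3) j, of 0] by auto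
    have "u ?t - ?W j = (u ?t - u ?a - (?t - ?a) *\<^sub>R g ?a)
        + ((u ?a - ?V j) + (h * \<theta> (Suc j)) *\<^sub>R (f ?a (u ?a) - f ?a (?V j)))"
      by (simp add: g_def algebra_simps)
    then have "norm (u ?t - ?W j) \<le> norm (u ?t - u ?a - (?t - ?a) *\<^sub>R g ?a)
        + (norm (u ?a - ?V j) + norm ((h * \<theta> (Suc j)) *\<^sub>R (f ?a (u ?a) - f ?a (?V j))))"
      by (metis norm_triangle_ineq norm_triangle_le add_left_mono)
    also have "norm (u ?t - u ?a - (?t - ?a) *\<^sub>R g ?a) \<le> C * h powr (1 + \<gamma>)"
      using local_defect[OF C stage_times(1)[OF h(1,3) j \<theta>[OF j]] h(2), of ?a ?a ?t]
        stage_times(2)[OF h(1,3) j \<theta>[OF j]] h by auto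
    also have "norm ((h * \<theta> (Suc j)) *\<^sub>R (f ?a (u ?a) - f ?a (?V j))) \<le> 1 * (L * norm (u ?a - ?V j))"
      unfolding norm_scaleR using s f_lipschitz[OF a, of "u ?a" "?V j"] by (intro mult_mono) auto
    finally show "norm (u ?t - ?W j) \<le> (1 + L) * norm (u ?a - ?V j) + C * h powr (1 + \<gamma>)"
      by (simp add: algebra_simps)
  qed (use C L_pos in \<open>auto simp: Let_def\<close>)
qed

end

subsection \<open>Random time points\<close>

locale randomized_ivp = hoelder_ivp T \<gamma> L K u\<^sub>0 f u + prob_space M
  for T \<gamma> L K :: real and u\<^sub>0 :: "'v::euclidean_space" and f u and M :: "'a measure" +
  fixes \<tau> :: "nat \<Rightarrow> 'a \<Rightarrow> real"
  assumes indep_\<tau>: "indep_vars (\<lambda>_. borel) \<tau> {1..}"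
    and distr_\<tau>: "\<And>j. j \<ge> 1 \<Longrightarrow> distr M lborel (\<tau> j) = uniform_measure lborel {0<..<1}"
begin

lemma \<tau>_meas: "\<tau> (Suc j) \<in> borel_measurable M"
  using indep_\<tau> by (auto simp: indep_vars_def)

lemma AE_\<tau>: "AE \<omega> in M. \<forall>j. \<tau> (Suc j) \<omega> \<in> {0..1}"
proof -
  have "AE \<omega> in M. \<tau> (Suc j) \<omega> \<in> {0..1}" for j
    using AE_uniform[OF \<tau>_meas distr_\<tau>, of j] by (auto elim: eventually_mono)
  then show ?thesis by (simp add: AE_all_countable)
qed

text \<open>Clamping changes \<open>\<tau>\<close> only on a null event and makes the defects bounded everywhere.\<close>

definition Z :: "real \<Rightarrow> nat \<Rightarrow> 'a \<Rightarrow> 'v" where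
  "Z h j \<omega> = defect h j (max 0 (min 1 (\<tau> (Suc j) \<omega>)))"

context
  fixes h :: real and N :: nat
  assumes h: "0 < h" "real N * h \<le> T"
begin

lemma defect_cont:
  assumes "j < N"
  shows "continuous_on {0..1} (defect h j)"
proof -
  have "continuous_on {0..1} (\<lambda>s. g (real j * h + s * h))"
    by (rule continuous_on_compose2[OF g_cont])
       (use stage_times(3)[OF h assms] in \<open>auto intro!: continuous_intros\<close>)
  then show ?thesis
    unfolding defect_def by (intro continuous_intros)
qed

lemma defect_clamp_meas:
  assumes "j < N"
  shows "(\<lambda>s. defect h j (max 0 (min 1 s))) \<in> borel_measurable borel"
proof (rule borel_measurable_continuous_onI)
  show "continuous_on UNIV (\<lambda>s. defect h j (max 0 (min 1 s)))"
    by (rule continuous_on_compose2[OF defect_cont[OF assms]]) (auto intro!: continuous_intros)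
qed

lemma integral_defect:
  assumes j: "j < N"
  shows "(\<integral>s. indicator {0..1} s *\<^sub>R (defect h j s \<bullet> b) \<partial>lborel) = 0"
proof -
  \<comment> \<open>An antiderivative of the defect. Subtracting the linear increment makes it agree
    at 0 and 1, which is the unbiasedness of the quadrature.\<close>
  define F where "F s = (u (real j * h + s * h) - s *\<^sub>R (u (real (Suc j) * h) - u (real j * h))) \<bullet> b" for s
  have "(F has_vector_derivative defect h j s \<bullet> b) (at s within {0..1})" if s: "s \<in> {0..1}" for s
  proof -
    have 1: "((\<lambda>s. real j * h + s * h) has_vector_derivative h) (at s within {0..1})"
      by (auto intro!: derivative_eq_intros simp: has_real_derivative_iff_has_vector_derivative[symmetric])
    have "(u has_vector_derivative g (real j * h + s * h))
        (at (real j * h + s * h) within (\<lambda>s. real j * h + s * h) ` {0..1})"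
      by (rule has_vector_derivative_within_subset[OF u_deriv])
         (use stage_times(3)[OF h j] s in auto)
    from vector_diff_chain_within[OF 1 this]
    have "((\<lambda>s. u (real j * h + s * h)) has_vector_derivative h *\<^sub>R g (real j * h + s * h)) (at s within {0..1})"
      by (simp add: o_def)
    then show ?thesis
      unfolding F_def defect_def
      by (auto intro!: derivative_eq_intros bounded_linear.has_vector_derivative[OF bounded_linear_inner_left])
  qed
  then have "(\<integral>s. indicator {0..1} s *\<^sub>R (defect h j s \<bullet> b) \<partial>lborel) = F 1 - F 0"
    by (intro integral_FTC_atLeastAtMost continuous_intros defect_cont[OF j]) auto
  then show ?thesis
    by (simp add: F_def algebra_simps)
qed

lemma expectation_Z:
  assumes j: "j < N"
  shows "expectation (\<lambda>\<omega>. Z h j \<omega> \<bullet> b) = 0"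
proof -
  have "expectation (\<lambda>\<omega>. Z h j \<omega> \<bullet> b)
      = (\<integral>s. indicator {0..1} s *\<^sub>R (defect h j (max 0 (min 1 s)) \<bullet> b) \<partial>lborel)"
    unfolding Z_def
    by (rule expectation_uniform[OF \<tau>_meas distr_\<tau>, of j "\<lambda>s. defect h j (max 0 (min 1 s)) \<bullet> b"])
       (use defect_clamp_meas[OF j] in auto)
  \<comment> \<open>Clamping is the identity on the range of integration.\<close>
  also have "\<dots> = (\<integral>s. indicator {0..1} s *\<^sub>R (defect h j s \<bullet> b) \<partial>lborel)"
    by (rule Bochner_Integration.integral_cong) (auto simp: indicator_def)
  finally show ?thesis using integral_defect[OF j] by simp
qed

lemma indep_Z: "indep_vars (\<lambda>_. borel) (\<lambda>j \<omega>. Z h j \<omega> \<bullet> b) {..<N}"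
proof -
  have "indep_vars (\<lambda>_. borel) (\<lambda>j. \<tau> (Suc j)) {..<N}"
    by (rule indep_vars_reindex_inj[where M' = "\<lambda>_. borel"], simp, rule indep_vars_subset[OF indep_\<tau>]) auto
  then show ?thesis
    unfolding Z_def
    by (rule indep_vars_compose2) (use defect_clamp_meas in auto)
qed

end

section \<open>Moments of the maximal defect sum and the resulting L^p bounds\<close>

text \<open>The squared bounds \<open>C\<^sup>2 * h powr (2 + 2 * \<gamma>)\<close> of the
  \<open>N\<close> terms add up to at most \<open>T * C\<^sup>2 * h powr (1 + 2 * \<gamma>)\<close>,
  the square of the scale. Adding absolute bounds would give only order
  \<open>\<gamma>\<close>.\<close>

lemma expectation_max_Z_le:
  assumes C: "\<And>s t. s \<in> {0..T} \<Longrightarrow> t \<in> {0..T} \<Longrightarrow> \<bar>t - s\<bar> \<le> 1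
      \<Longrightarrow> norm (g t - g s) \<le> C * \<bar>t - s\<bar> powr \<gamma>" "C > 0"
    and h: "0 < h" "h \<le> 1" "real N * h \<le> T" and b: "b \<in> Basis" and p: "p > 0"
  shows "integrable M (\<lambda>\<omega>. (MAX k\<in>{..N}. \<bar>\<Sum>j<k. Z h j \<omega> \<bullet> b\<bar>) powr p)" (is ?int)
    and "expectation (\<lambda>\<omega>. (MAX k\<in>{..N}. \<bar>\<Sum>j<k. Z h j \<omega> \<bullet> b\<bar>) powr p)
           \<le> 16 * (p * (C * sqrt T * h powr (1/2 + \<gamma>))) powr p" (is ?le)
proof -
  have le: "\<bar>Z h j \<omega> \<bullet> b\<bar> \<le> C * h powr (1 + \<gamma>)" if "j < N" for j \<omega>
    using norm_defect_le[OF C h that] Basis_le_norm[OF b, of "Z h j \<omega>"]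
    unfolding Z_def by (force intro: order_trans)
  have pos: "C * sqrt T * h powr (1/2 + \<gamma>) > 0"
    using C T_pos h by simp
  have "real N * (C * h powr (1 + \<gamma>))\<^sup>2 = C\<^sup>2 * (real N * h) * (h powr (1/2 + \<gamma>))\<^sup>2"
  proof -
    have "h * (h powr (1/2 + \<gamma>))\<^sup>2 = h powr (1 + (1/2 + \<gamma>) + (1/2 + \<gamma>))"
      using h by (simp only: powr_add power2_eq_square powr_one mult.assoc)
    also have "\<dots> = (h powr (1 + \<gamma>))\<^sup>2"
      by (simp add: power2_eq_square flip: powr_add)
    finally show ?thesis by (simp add: power_mult_distrib)
  qed
  also have "\<dots> \<le> C\<^sup>2 * T * (h powr (1/2 + \<gamma>))\<^sup>2"
    using h by (intro mult_right_mono mult_left_mono) auto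
  also have "\<dots> = (C * sqrt T * h powr (1/2 + \<gamma>))\<^sup>2"
    using T_pos by (simp add: power_mult_distrib)
  finally have "real N * (C * h powr (1 + \<gamma>))\<^sup>2 \<le> (C * sqrt T * h powr (1/2 + \<gamma>))\<^sup>2" .
  from expectation_max_sum_powr_le[OF indep_Z[OF h(1,3)] le expectation_Z[OF h(1,3)] pos this p]
  show ?int ?le by auto
qed

text \<open>Turns a pathwise estimate into a norm bound. In \<open>c\<close>, the factor
  \<open>2 powr p\<close> separates the stage error from the defects, \<open>d powr p\<close>
  separates the coordinates, and each of the \<open>d\<close> coordinates contributes the moment
  bound; neither \<open>h\<close> nor \<open>N\<close> occurs.\<close>

lemma Lp_rate:
  assumes C: "\<And>s t. s \<in> {0..T} \<Longrightarrow> t \<in> {0..T} \<Longrightarrow> \<bar>t - s\<bar> \<le> 1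
      \<Longrightarrow> norm (g t - g s) \<le> C * \<bar>t - s\<bar> powr \<gamma>" "C > 0"
    and h: "0 < h" "h \<le> 1" "real N * h \<le> T" and p: "p > 0" and q: "q \<le> 1/2 + \<gamma>"
    and A: "A \<ge> 0" and D: "D \<ge> 0"
    and X': "X' \<in> borel_measurable M"
    and X_eq: "\<And>\<omega>. (\<And>j. \<tau> (Suc j) \<omega> \<in> {0..1}) \<Longrightarrow> X' \<omega> = X \<omega>"
    and X: "\<And>\<omega> R. (\<And>j. \<tau> (Suc j) \<omega> \<in> {0..1})
      \<Longrightarrow> (\<And>n. n \<le> N \<Longrightarrow> norm (\<Sum>j<n. defect h j (\<tau> (Suc j) \<omega>)) \<le> R)
      \<Longrightarrow> \<bar>X \<omega>\<bar> \<le> A * (D * h powr q + R)"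
  defines "d \<equiv> real DIM('v)"
  defines "c \<equiv> A * (2 powr p * (D powr p + d powr p * (d * (16 * (p * (C * sqrt T)) powr p)))) powr (1 / p)"
  shows "in_Lp M p X \<and> Lp_norm M p X \<le> c * h powr q"
proof -
  define R where "R b \<omega> = (MAX k\<in>{..N}. \<bar>\<Sum>j<k. Z h j \<omega> \<bullet> b\<bar>)" for b \<omega>
  define Y where "Y \<omega> = A powr p * (2 powr p * ((D * h powr q) powr p
      + d powr p * (\<Sum>b\<in>Basis. R b \<omega> powr p)))" for \<omega>
  have R_nonneg: "0 \<le> R b \<omega>" for b \<omega>
    by (auto simp: R_def Max_ge_iff)
  have R_int: "integrable M (\<lambda>\<omega>. R b \<omega> powr p)"
    and R_le: "expectation (\<lambda>\<omega>. R b \<omega> powr p) \<le> 16 * (p * (C * sqrt T)) powr p * (h powr q) powr p"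
    if b: "b \<in> Basis" for b
  proof -
    show "integrable M (\<lambda>\<omega>. R b \<omega> powr p)"
      unfolding R_def by (rule expectation_max_Z_le(1)[OF C h b p])
    have "expectation (\<lambda>\<omega>. R b \<omega> powr p) \<le> 16 * (p * (C * sqrt T * h powr (1/2 + \<gamma>))) powr p"
      unfolding R_def by (rule expectation_max_Z_le(2)[OF C h b p])
    \<comment> \<open>As \<open>h \<le> 1\<close>, the exponent may be lowered to \<open>q\<close>,
      so that both error terms share one power of \<open>h\<close>.\<close>
    also have "\<dots> \<le> 16 * (p * (C * sqrt T * h powr q)) powr p"
      using p C T_pos q h by (intro mult_left_mono powr_mono2 powr_mono') auto
    also have "\<dots> = 16 * (p * (C * sqrt T)) powr p * (h powr q) powr p"
      using p C T_pos by (simp add: powr_mult mult.assoc)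
    finally show "expectation (\<lambda>\<omega>. R b \<omega> powr p) \<le> 16 * (p * (C * sqrt T)) powr p * (h powr q) powr p" .
  qed
  have Y_int: "integrable M Y"
    unfolding Y_def using R_int by simp
  have "expectation Y = A powr p * (2 powr p * ((D * h powr q) powr p
      + d powr p * (\<Sum>b\<in>Basis. expectation (\<lambda>\<omega>. R b \<omega> powr p))))"
    unfolding Y_def using R_int by (simp add: prob_space Bochner_Integration.integral_sum)
  also have "\<dots> \<le> A powr p * (2 powr p * ((D * h powr q) powr p
      + d powr p * (d * (16 * (p * (C * sqrt T)) powr p * (h powr q) powr p))))"
  proof (intro mult_left_mono add_left_mono)
    show "(\<Sum>b\<in>Basis. expectation (\<lambda>\<omega>. R b \<omega> powr p))
        \<le> d * (16 * (p * (C * sqrt T)) powr p * (h powr q) powr p)"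
      unfolding d_def by (rule sum_bounded_above) (rule R_le)
  qed auto
  also have "\<dots> = (A * h powr q) powr p *
      (2 powr p * (D powr p + d powr p * (d * (16 * (p * (C * sqrt T)) powr p))))"
    using A D by (simp add: powr_mult algebra_simps)
  also have "\<dots> = (c * h powr q) powr p"
  proof -
    define k where "k = 2 powr p * (D powr p + d powr p * (d * (16 * (p * (C * sqrt T)) powr p)))"
    have "k \<ge> 0" by (simp add: k_def d_def)
    moreover have "c = A * k powr (1 / p)" by (simp add: c_def k_def)
    ultimately show ?thesis
      unfolding k_def[symmetric] using A p by (simp add: powr_mult powr_powr)
  qed
  finally have Y_le: "expectation Y \<le> (c * h powr q) powr p" .
  have X_le: "\<bar>X \<omega>\<bar> powr p \<le> Y \<omega>" if \<omega>: "\<And>j. \<tau> (Suc j) \<omega> \<in> {0..1}" for \<omega>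
  proof -
    \<comment> \<open>The scalar maximal inequality enters by coordinates: the Euclidean norm is at
      most the sum of the absolute coordinates.\<close>
    have "norm (\<Sum>j<n. defect h j (\<tau> (Suc j) \<omega>)) \<le> (\<Sum>b\<in>Basis. R b \<omega>)" if "n \<le> N" for n
    proof -
      have "defect h j (\<tau> (Suc j) \<omega>) = Z h j \<omega>" for j
        using \<omega>[of j] by (simp add: Z_def)
      then have "norm (\<Sum>j<n. defect h j (\<tau> (Suc j) \<omega>)) \<le> (\<Sum>b\<in>Basis. \<bar>(\<Sum>j<n. Z h j \<omega>) \<bullet> b\<bar>)"
        by (simp add: norm_le_l1)
      also have "\<dots> \<le> (\<Sum>b\<in>Basis. R b \<omega>)"
        using that unfolding R_def by (intro sum_mono Max_ge) (auto simp: inner_sum_left)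
      finally show ?thesis .
    qed
    from X[OF \<omega> this] have "\<bar>X \<omega>\<bar> powr p \<le> (A * (D * h powr q + (\<Sum>b\<in>Basis. R b \<omega>))) powr p"
      using p by (intro powr_mono2) auto
    also have "\<dots> = A powr p * (D * h powr q + (\<Sum>b\<in>Basis. R b \<omega>)) powr p"
      using A by (simp add: powr_mult)
    \<comment> \<open>The two summands are read as a family indexed by the booleans.\<close>
    also have "(D * h powr q + (\<Sum>b\<in>Basis. R b \<omega>)) powr p
        \<le> 2 powr p * ((D * h powr q) powr p + (\<Sum>b\<in>Basis. R b \<omega>) powr p)"
      using sum_powr_le[of UNIV "\<lambda>b. if b then D * h powr q else (\<Sum>b\<in>Basis. R b \<omega>)" p] p D R_nonneg
      by (simp add: UNIV_bool sum_nonneg add.commute)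
    also have "(\<Sum>b\<in>Basis. R b \<omega>) powr p \<le> d powr p * (\<Sum>b\<in>Basis. R b \<omega> powr p)"
      unfolding d_def using R_nonneg p by (intro sum_powr_le) auto
    finally show ?thesis
      unfolding Y_def by (simp add: mult_left_mono)
  qed
  have "AE \<omega> in M. X' \<omega> = X \<omega>"
    using AE_\<tau> by eventually_elim (use X_eq in auto)
  moreover have "AE \<omega> in M. \<bar>X \<omega>\<bar> powr p \<le> Y \<omega>"
    using AE_\<tau> by eventually_elim (use X_le in auto)
  moreover have "c * h powr q \<ge> 0"
    unfolding c_def using A by simp
  ultimately show ?thesis
    using in_Lp_Lp_norm_le[OF X' _ Y_int _ p _ Y_le] by blast
qed

text \<open>The maximum is attained at some node, so a bound at each node suffices.
  \<open>V'\<close> is a measurable version of the scheme that agrees with it off a null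
  event.\<close>

lemma max_error_rate:
  assumes C: "\<And>s t. s \<in> {0..T} \<Longrightarrow> t \<in> {0..T} \<Longrightarrow> \<bar>t - s\<bar> \<le> 1
      \<Longrightarrow> norm (g t - g s) \<le> C * \<bar>t - s\<bar> powr \<gamma>" "C > 0"
    and p: "p > 0" and q: "q \<le> 1/2 + \<gamma>" and A: "A > 0" and D: "D \<ge> 0"
    and V'_meas: "\<And>h n. V' h n \<in> borel_measurable M"
    and V'_eq: "\<And>h N n \<omega>. 0 < h \<Longrightarrow> real N * h \<le> T \<Longrightarrow> n \<le> N \<Longrightarrow>
      (\<And>j. \<tau> (Suc j) \<omega> \<in> {0..1}) \<Longrightarrow> V' h n \<omega> = V h (\<lambda>j. \<tau> j \<omega>) n"
    and error: "\<And>h N \<theta> R n. 0 < h \<Longrightarrow> h < 1 \<Longrightarrow> real N * h \<le> T \<Longrightarrow>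
      (\<And>j. j < N \<Longrightarrow> \<theta> (Suc j) \<in> {0..1}) \<Longrightarrow>
      (\<And>n. n \<le> N \<Longrightarrow> norm (\<Sum>j<n. defect h j (\<theta> (Suc j))) \<le> R) \<Longrightarrow> n \<le> N \<Longrightarrow>
      norm (u (real n * h) - V h \<theta> n) \<le> A * (D * h powr q + R)"
  shows "\<exists>c>0. \<forall>h\<in>{0<..<1}.
    in_Lp M p (\<lambda>\<omega>. max_error T h u (V h (\<lambda>j. \<tau> j \<omega>))) \<and>
    Lp_norm M p (\<lambda>\<omega>. max_error T h u (V h (\<lambda>j. \<tau> j \<omega>))) \<le> c * h powr q"
proof (intro exI conjI ballI)
  let ?d = "real DIM('v)"
  let ?c = "A * (2 powr p * (D powr p + ?d powr p * (?d * (16 * (p * (C * sqrt T)) powr p)))) powr (1 / p)"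
  \<comment> \<open>Positivity comes from the defect term, as \<open>D\<close> may be 0.\<close>
  have "0 < 2 powr p * (D powr p + ?d powr p * (?d * (16 * (p * (C * sqrt T)) powr p)))"
    using C p T_pos by (intro mult_pos_pos add_nonneg_pos) auto
  then have "0 < (2 powr p * (D powr p + ?d powr p * (?d * (16 * (p * (C * sqrt T)) powr p)))) powr (1 / p)"
    unfolding powr_gt_zero by (metis less_irrefl)
  then show "0 < ?c" using A by (rule mult_pos_pos[rotated])
  fix h :: real assume "h \<in> {0<..<1}"
  then have h: "0 < h" "h < 1" by auto
  define N where "N = num_steps T h"
  have N: "real N * h \<le> T"
    unfolding N_def using T_pos h by (intro num_steps) auto
  have "in_Lp M p (\<lambda>\<omega>. max_error T h u (V h (\<lambda>j. \<tau> j \<omega>))) \<and>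
    Lp_norm M p (\<lambda>\<omega>. max_error T h u (V h (\<lambda>j. \<tau> j \<omega>))) \<le> ?c * h powr q"
  proof (rule Lp_rate[OF C h(1) _ N p q _ D])
    show "(\<lambda>\<omega>. MAX n\<in>{0..N}. norm (u (real n * h) - V' h n \<omega>)) \<in> borel_measurable M"
      using V'_meas by (intro borel_measurable_Max) auto
    fix \<omega> assume \<omega>: "\<And>j. \<tau> (Suc j) \<omega> \<in> {0..1}"
    show "(MAX n\<in>{0..N}. norm (u (real n * h) - V' h n \<omega>)) = max_error T h u (V h (\<lambda>j. \<tau> j \<omega>))"
      unfolding max_error_def N_def[symmetric]
      using V'_eq[OF h(1) N _ \<omega>] by (intro arg_cong[where f = Max] image_cong) auto
    fix R assume R: "\<And>n. n \<le> N \<Longrightarrow> norm (\<Sum>j<n. defect h j (\<tau> (Suc j) \<omega>)) \<le> R"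
    let ?X = "max_error T h u (V h (\<lambda>j. \<tau> j \<omega>))"
    have "?X \<in> (\<lambda>n. norm (u (real n * h) - V h (\<lambda>j. \<tau> j \<omega>) n)) ` {0..N}"
      unfolding max_error_def N_def[symmetric] by (rule Max_in) auto
    then obtain n where n: "n \<le> N" "?X = norm (u (real n * h) - V h (\<lambda>j. \<tau> j \<omega>) n)"
      by auto
    show "\<bar>?X\<bar> \<le> A * (D * h powr q + R)"
      unfolding n(2) abs_norm_cancel using \<omega> R n(1) by (intro error[OF h N]) auto
  qed (use A h in auto)
  then show "in_Lp M p (\<lambda>\<omega>. max_error T h u (V h (\<lambda>j. \<tau> j \<omega>)))"
    and "Lp_norm M p (\<lambda>\<omega>. max_error T h u (V h (\<lambda>j. \<tau> j \<omega>))) \<le> ?c * h powr q"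
    by auto
qed

text \<open>Extending \<open>f\<close> continuously in time makes the schemes measurable functions of \<open>\<tau>\<close>; almost
  surely they are not affected.\<close>

definition f_ext :: "real \<Rightarrow> 'v \<Rightarrow> 'v" where
  "f_ext t x = f (max 0 (min T t)) x"

lemma f_ext_eq: "t \<in> {0..T} \<Longrightarrow> f_ext t x = f t x"
  by (simp add: f_ext_def)

lemma f_ext_meas:
  assumes "a \<in> borel_measurable M" "v \<in> borel_measurable M"
  shows "(\<lambda>\<omega>. f_ext (a \<omega>) (v \<omega>)) \<in> borel_measurable M"
proof (rule borel_measurable_continuous_Pair[OF assms])
  show "continuous_on UNIV (\<lambda>z. f_ext (fst z) (snd z))"
  proof -
    have "continuous_on UNIV (\<lambda>z. (\<lambda>(t, x). f t x) (max 0 (min T (fst z)), snd z))"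
      by (rule continuous_on_compose2[OF f_cont]) (use T_pos in \<open>auto intro!: continuous_intros\<close>)
    then show ?thesis by (simp add: f_ext_def)
  qed
qed

lemma rand_euler_meas: "(\<lambda>\<omega>. rand_euler f_ext u\<^sub>0 h (\<lambda>j. \<tau> j \<omega>) n) \<in> borel_measurable M"
proof (induction n)
  case (Suc n)
  then show ?case
    using \<tau>_meas[of n]
    by (auto intro!: borel_measurable_add borel_measurable_scaleR f_ext_meas borel_measurable_times)
qed simp

lemma rand_rk_meas: "(\<lambda>\<omega>. rand_rk f_ext u\<^sub>0 h (\<lambda>j. \<tau> j \<omega>) n) \<in> borel_measurable M"
proof (induction n)
  case (Suc n)
  then show ?case
    using \<tau>_meas[of n]
    by (auto simp: Let_def
        intro!: borel_measurable_add borel_measurable_scaleR f_ext_meas borel_measurable_times)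
qed simp

lemma rand_euler_f_ext:
  assumes "0 < h" "real N * h \<le> T" "\<And>j. \<theta> (Suc j) \<in> {0..1}" "n \<le> N"
  shows "rand_euler f_ext u\<^sub>0 h \<theta> n = rand_euler f u\<^sub>0 h \<theta> n"
  using \<open>n \<le> N\<close>
proof (induction n)
  case (Suc n)
  then show ?case
    using stage_times(3)[OF assms(1,2) _ assms(3), of n n] by (simp add: f_ext_eq)
qed simp

lemma rand_rk_f_ext:
  assumes "0 < h" "real N * h \<le> T" "\<And>j. \<theta> (Suc j) \<in> {0..1}" "n \<le> N"
  shows "rand_rk f_ext u\<^sub>0 h \<theta> n = rand_rk f u\<^sub>0 h \<theta> n"
  using \<open>n \<le> N\<close>
proof (induction n)
  case (Suc n)
  then show ?case
    using stage_times(3)[OF assms(1,2) _ assms(3), of n n] stage_times(3)[OF assms(1,2), of n 0]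
    by (simp add: f_ext_eq Let_def)
qed simp

section \<open>Convergence rates of the two schemes\<close>

lemma rand_euler_rate:
  assumes p: "p > 0"
  shows "\<exists>c>0. \<forall>h\<in>{0<..<1}.
    in_Lp M p (\<lambda>\<omega>. max_error T h u (rand_euler f u\<^sub>0 h (\<lambda>j. \<tau> j \<omega>))) \<and>
    Lp_norm M p (\<lambda>\<omega>. max_error T h u (rand_euler f u\<^sub>0 h (\<lambda>j. \<tau> j \<omega>)))
      \<le> c * h powr min (1/2 + \<gamma>) 1"
proof -
  obtain B where B: "B > 0" "\<And>t. t \<in> {0..T} \<Longrightarrow> norm (g t) \<le> B"
    by (rule g_bounded) blast
  obtain C where C: "C > 0"
    "\<And>s t. s \<in> {0..T} \<Longrightarrow> t \<in> {0..T} \<Longrightarrow> \<bar>t - s\<bar> \<le> 1 \<Longrightarrow> norm (g t - g s) \<le> C * \<bar>t - s\<bar> powr \<gamma>"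
    by (rule g_hoelder) blast
  show ?thesis
  proof (rule max_error_rate[where V = "rand_euler f u\<^sub>0", OF C(2,1) p _ _ _ rand_euler_meas rand_euler_f_ext])
    fix h N \<theta> R n
    assume h: "0 < h" "h < 1" "real N * h \<le> T" and \<theta>: "\<And>j. j < N \<Longrightarrow> \<theta> (Suc j) \<in> {0..1}"
      and R: "\<And>n. n \<le> N \<Longrightarrow> norm (\<Sum>j<n. defect h j (\<theta> (Suc j))) \<le> R" and n: "n \<le> N"
    have "norm (u (real n * h) - rand_euler f u\<^sub>0 h \<theta> n) \<le> exp (L * T) * (T * L * (B * h) + R)"
      by (rule rand_euler_error[OF B(2,1) h(1,3) \<theta> R n])
    \<comment> \<open>The first-order stage error is what caps the Euler rate at 1.\<close>
    also have "h \<le> h powr min (1/2 + \<gamma>) 1"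
      using powr_mono'[of "min (1/2 + \<gamma>) 1" 1 h] h by simp
    finally show "norm (u (real n * h) - rand_euler f u\<^sub>0 h \<theta> n)
        \<le> exp (L * T) * ((T * L * B) * h powr min (1/2 + \<gamma>) 1 + R)"
      using T_pos L_pos B by (simp add: mult.assoc)
  qed (use T_pos L_pos B in auto)
qed

lemma rand_rk_rate:
  assumes p: "p > 0"
  shows "\<exists>c>0. \<forall>h\<in>{0<..<1}.
    in_Lp M p (\<lambda>\<omega>. max_error T h u (rand_rk f u\<^sub>0 h (\<lambda>j. \<tau> j \<omega>))) \<and>
    Lp_norm M p (\<lambda>\<omega>. max_error T h u (rand_rk f u\<^sub>0 h (\<lambda>j. \<tau> j \<omega>)))
      \<le> c * h powr (1/2 + \<gamma>)"
proof -
  obtain C where C: "C > 0"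
    "\<And>s t. s \<in> {0..T} \<Longrightarrow> t \<in> {0..T} \<Longrightarrow> \<bar>t - s\<bar> \<le> 1 \<Longrightarrow> norm (g t - g s) \<le> C * \<bar>t - s\<bar> powr \<gamma>"
    by (rule g_hoelder) blast
  show ?thesis
  proof (rule max_error_rate[where V = "rand_rk f u\<^sub>0", OF C(2,1) p _ _ _ rand_rk_meas rand_rk_f_ext])
    fix h N \<theta> R n
    assume h: "0 < h" "h < 1" "real N * h \<le> T" and \<theta>: "\<And>j. j < N \<Longrightarrow> \<theta> (Suc j) \<in> {0..1}"
      and R: "\<And>n. n \<le> N \<Longrightarrow> norm (\<Sum>j<n. defect h j (\<theta> (Suc j))) \<le> R" and n: "n \<le> N"
    have "norm (u (real n * h) - rand_rk f u\<^sub>0 h \<theta> n)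
        \<le> exp (L * (1 + L) * T) * (T * L * (C * h powr (1 + \<gamma>)) + R)"
      using h by (intro rand_rk_error[OF C(2,1) _ _ _ \<theta> R n]) auto
    \<comment> \<open>Here the stage error is of higher order than the random fluctuation, which
      alone fixes the rate.\<close>
    also have "h powr (1 + \<gamma>) \<le> h powr (1/2 + \<gamma>)"
      using h by (intro powr_mono') auto
    finally show "norm (u (real n * h) - rand_rk f u\<^sub>0 h \<theta> n)
        \<le> exp (L * (1 + L) * T) * ((T * L * C) * h powr (1/2 + \<gamma>) + R)"
      using T_pos L_pos C by (simp add: mult.assoc)
  qed (use T_pos L_pos C in auto)
qed

end

theorem theorem5p2:
  fixes M :: "'a measure"
    and \<tau> :: "nat \<Rightarrow> 'a \<Rightarrow> real"
    and T \<gamma> L K :: real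
    and u\<^sub>0 :: "real ^ 'd"
    and f :: "real \<Rightarrow> real ^ 'd \<Rightarrow> real ^ 'd"
    and u :: "real \<Rightarrow> real ^ 'd"
  assumes "prob_space M"
    and "prob_space.indep_vars M (\<lambda>_. borel) \<tau> {1..}"
    and "\<And>j. j \<ge> 1 \<Longrightarrow> distr M lborel (\<tau> j) = uniform_measure lborel {0<..<1}"
    and "T > 0"
    and "0 < \<gamma>" and "\<gamma> \<le> 1"
    and "continuous_on ({0..T} \<times> UNIV) (\<lambda>(t, x). f t x)"
    and "L > 0" and "K > 0"
    and "\<And>t x\<^sub>1 x\<^sub>2. t \<in> {0..T} \<Longrightarrow> norm (f t x\<^sub>1 - f t x\<^sub>2) \<le> L * norm (x\<^sub>1 - x\<^sub>2)"
    and "\<And>t\<^sub>1 t\<^sub>2 x. t\<^sub>1 \<in> {0..T} \<Longrightarrow> t\<^sub>2 \<in> {0..T} \<Longrightarrow>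
           norm (f t\<^sub>1 x - f t\<^sub>2 x) \<le> K * (1 + norm x) * \<bar>t\<^sub>1 - t\<^sub>2\<bar> powr \<gamma>"
    and "solves_ivp T f u\<^sub>0 u"
  shows "(\<forall>p\<ge>2. \<exists>C\<^sub>U>0. \<forall>h\<in>{0<..<1}.
            in_Lp M p (\<lambda>\<omega>. max_error T h u (rand_euler f u\<^sub>0 h (\<lambda>j. \<tau> j \<omega>))) \<and>
            Lp_norm M p (\<lambda>\<omega>. max_error T h u (rand_euler f u\<^sub>0 h (\<lambda>j. \<tau> j \<omega>)))
              \<le> C\<^sub>U * h powr min (1/2 + \<gamma>) 1) \<and>
         (\<forall>p\<ge>2. \<exists>C\<^sub>V>0. \<forall>h\<in>{0<..<1}.
            in_Lp M p (\<lambda>\<omega>. max_error T h u (rand_rk f u\<^sub>0 h (\<lambda>j. \<tau> j \<omega>))) \<and>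
            Lp_norm M p (\<lambda>\<omega>. max_error T h u (rand_rk f u\<^sub>0 h (\<lambda>j. \<tau> j \<omega>)))
              \<le> C\<^sub>V * h powr (1/2 + \<gamma>))"
proof -
  interpret prob_space M by fact
  interpret randomized_ivp T \<gamma> L K u\<^sub>0 f u M \<tau>
    by unfold_locales (fact assms)+
  show ?thesis
    using rand_euler_rate rand_rk_rate by simp
qed

end
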